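(* Let $(M,E_{1,0})$ be a compact strongly pseudoconvex CR manifold with Levi distribution $E$ and contact form $\theta$. Let $\mathcal{P}=E_{1,0}$ be the CR polarization of the contact manifold $(M,E)$ given by the CR structure, and let $\mathbb{L}=M\times\mathbb{C}$ be the trivial line bundle with Hermitian metric $h_x((x,z_1),(x,z_2))=z_1\overline{z}_2$ and connection $\nabla$ given by $\nabla_Xs=(x,\,X\cdot f-i\theta(X)f)$ for $s(x)=(x,f(x))$, which is a quantum bundle over $(M,E,\Omega)$ with $\Omega=-d\theta|_{E\otimes E}$. Then the polarized sections of $\mathbb{L}$ are the CR-holomorphic sections of $\mathbb{L}$, i.e. those with $\overline{\partial}_{\mathbb{L}}s=0$. Thus $$Q(M)=\{s\in\Gamma_{L^2}(M,\mathbb{L})\mid\nabla_{\overline Z}s=0\ \text{for all }Z\in\Gamma(M,\mathcal{P})\}$$ is isomorphic to the space of CR-holomorphic $L^2$ functions on $M$.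
   Context: $\dim M=2n+1$; $E=\ker\theta\subset TM$ is the contact (Levi) distribution, $E\otimes\mathbb{C}=E_{1,0}\oplus E_{0,1}$ with $E_{0,1}=\overline{E_{1,0}}$, $E_{1,0}$ formally integrable, $J\in\mathrm{End}(E)$ has $+i$-eigenbundle $E_{1,0}$, and $\theta$ is such that $g_\theta(X,Y)=d\theta(JX,Y)+\theta(X)\theta(Y)$ is a Riemannian metric ($J$ extended by $0$ on the Reeb field $\xi$). A CR polarization of $(M,E)$ is a subbundle $\mathcal P\subset TM\otimes\mathbb{C}$ that is isotropic, formally integrable, with $\mathcal P\cap\overline{\mathcal P}=0$ and $\mathcal P\oplus\overline{\mathcal P}=E\otimes\mathbb{C}$. A section $s$ of $\mathbb{L}$ is polarized if $\nabla_{\overline Z}s=0$ for all $Z\in\Gamma(M,\mathcal P)$. A quantum bundle over $(M,E,\Omega)$ is a Hermitian line bundle with connection whose curvature form restricted to $E\otimes E$ equals $i\Omega$. For a complex function $f$, $\overline{\partial}_bf\in\Gamma(M,E_{0,1}^* )$ is given by $(\overline{\partial}_bf)(\overline Z)=\overline Z\cdot f$ for $Z\in E_{1,0}$; $f$ is CR-holomorphic if $\overline{\partial}_bf=0$. The CR-holomorphic structure on $\mathbb{L}$ is $\overline{\partial}_{\mathbb{L}}:\Gamma(M,\mathbb{L})\to\Gamma(M,E_{0,1}^*\otimes\mathbb{L})$, $(\overline{\partial}_{\mathbb{L}}s)(x)=(x,(\overline{\partial}_bf)_x)$ for $s(x)=(x,f(x))$. $\Gamma_{L^2}(M,\mathbb{L})$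 is the space of $L^2$ sections with respect to $\langle s_1,s_2\rangle=\int_Mh(s_1,s_2)\,\theta\wedge(d\theta)^n/n!$; for $L^2$ sections or functions the differential equations are understood in the sense of distributions. *)

theory Defs
  imports "HOL-Analysis.Analysis"
begin

section \<open>Smooth manifolds\<close>

text \<open>The manifold is the whole type \<open>'m\<close>; topological requirements on \<open>M\<close> are sort constraints on
  \<open>'m\<close> (Hausdorff, second countable) or explicit assumptions (compactness).\<close>

primrec Ck_on :: "nat \<Rightarrow> 'e::euclidean_space set \<Rightarrow> ('e \<Rightarrow> 'b::real_normed_vector) \<Rightarrow> bool" where
  "Ck_on 0 S f \<longleftrightarrow> continuous_on S f"
| "Ck_on (Suc k) S f \<longleftrightarrow>
     (\<forall>x\<in>S. f differentiable (at x)) \<and> (\<forall>b\<in>Basis. Ck_on k S (\<lambda>x. frechet_derivative f (at x) b))"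

definition smooth_on :: "'e::euclidean_space set \<Rightarrow> ('e \<Rightarrow> 'b::real_normed_vector) \<Rightarrow> bool" where
  "smooth_on S f \<longleftrightarrow> (\<forall>k. Ck_on k S f)"

type_synonym ('m, 'k) chart = "'m set \<times> ('m \<Rightarrow> real ^ 'k)"

definition is_chart :: "('m::topological_space, 'k::finite) chart \<Rightarrow> bool" where
  "is_chart = (\<lambda>(U, \<phi>). open U \<and> open (\<phi> ` U) \<and> inj_on \<phi> U \<and> homeomorphism U (\<phi> ` U) \<phi> (inv_into U \<phi>))"

definition smooth_atlas :: "('m::topological_space, 'k::finite) chart set \<Rightarrow> bool" where
  "smooth_atlas A \<longleftrightarrow>
     (\<forall>c\<in>A. is_chart c) \<and> (\<Union>c\<in>A. fst c) = UNIV \<and>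
     (\<forall>(U, \<phi>)\<in>A. \<forall>(V, \<psi>)\<in>A. smooth_on (\<phi> ` (U \<inter> V)) (\<psi> \<circ> inv_into U \<phi>))"

definition smooth_fun_on ::
  "('m, 'k::finite) chart set \<Rightarrow> 'm set \<Rightarrow> ('m \<Rightarrow> 'b::real_normed_vector) \<Rightarrow> bool" where
  "smooth_fun_on A W f \<longleftrightarrow> (\<forall>(U, \<phi>)\<in>A. smooth_on (\<phi> ` (U \<inter> W)) (f \<circ> inv_into U \<phi>))"

abbreviation smooth_fun :: "('m, 'k::finite) chart set \<Rightarrow> ('m \<Rightarrow> 'b::real_normed_vector) \<Rightarrow> bool" where
  "smooth_fun A f \<equiv> smooth_fun_on A UNIV f"

section \<open>Complexified tangent bundle\<close>

text \<open>A complex tangent vector at \<open>p\<close> is a complex-linear derivation at \<open>p\<close> of the algebra of smooth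
  complex functions on \<open>M\<close>. The real tangent space consists of those derivations that commute with
  complex conjugation. Derivations are set to \<open>0\<close> off the smooth functions, so that equality of
  vectors is equality of HOL functions.\<close>

type_synonym 'm cvector = "('m \<Rightarrow> complex) \<Rightarrow> complex"
type_synonym 'm cfield = "'m \<Rightarrow> 'm cvector"

definition vzero :: "'m cvector" where "vzero = (\<lambda>f. 0)"
definition vadd :: "'m cvector \<Rightarrow> 'm cvector \<Rightarrow> 'm cvector" where "vadd v w = (\<lambda>f. v f + w f)"
definition vscale :: "complex \<Rightarrow> 'm cvector \<Rightarrow> 'm cvector" where "vscale c v = (\<lambda>f. c * v f)"
definition vcnj :: "'m cvector \<Rightarrow> 'm cvector" where "vcnj v = (\<lambda>f. cnj (v (\<lambda>x. cnj (f x))))"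

definition ctangent :: "('m, 'k::finite) chart set \<Rightarrow> 'm \<Rightarrow> 'm cvector set" where
  "ctangent A p = {v.
     (\<forall>f g. smooth_fun A f \<longrightarrow> smooth_fun A g \<longrightarrow>
        v (\<lambda>x. f x + g x) = v f + v g \<and> v (\<lambda>x. f x * g x) = f p * v g + g p * v f) \<and>
     (\<forall>f c. smooth_fun A f \<longrightarrow> v (\<lambda>x. c * f x) = c * v f) \<and>
     (\<forall>f. \<not> smooth_fun A f \<longrightarrow> v f = 0)}"

definition rtangent :: "('m, 'k::finite) chart set \<Rightarrow> 'm \<Rightarrow> 'm cvector set" where
  "rtangent A p = {v \<in> ctangent A p. vcnj v = v}"

definition coord_vec :: "('m, 'k::finite) chart set \<Rightarrow> ('m, 'k) chart \<Rightarrow> 'm \<Rightarrow> 'k \<Rightarrow> 'm cvector" where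
  "coord_vec A = (\<lambda>(U, \<phi>) p i f.
     if smooth_fun A f then frechet_derivative (f \<circ> inv_into U \<phi>) (at (\<phi> p)) (axis i 1) else 0)"

definition smooth_field_on :: "('m, 'k::finite) chart set \<Rightarrow> 'm set \<Rightarrow> 'm cfield \<Rightarrow> bool" where
  "smooth_field_on A W X \<longleftrightarrow>
     (\<forall>p\<in>W. X p \<in> ctangent A p) \<and> (\<forall>f. smooth_fun A f \<longrightarrow> smooth_fun_on A W (\<lambda>p. X p f))"

definition fields :: "('m, 'k::finite) chart set \<Rightarrow> 'm cfield set" where
  "fields A = {X. smooth_field_on A UNIV X}"

definition real_fields :: "('m, 'k::finite) chart set \<Rightarrow> 'm cfield set" where
  "real_fields A = {X \<in> fields A. \<forall>p. X p \<in> rtangent A p}"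

definition bracket :: "'m cfield \<Rightarrow> 'm cfield \<Rightarrow> 'm cfield" where
  "bracket X Y = (\<lambda>p f. X p (\<lambda>q. Y q f) - Y p (\<lambda>q. X q f))"

section \<open>Subbundles of the complexified tangent bundle\<close>

definition subbundle :: "('m::topological_space, 'k::finite) chart set \<Rightarrow> nat \<Rightarrow> ('m \<Rightarrow> 'm cvector set) \<Rightarrow> bool" where
  "subbundle A r P \<longleftrightarrow> (\<forall>p. \<exists>W Z. open W \<and> p \<in> W \<and> (\<forall>j<r. smooth_field_on A W (Z j)) \<and>
     (\<forall>q\<in>W. P q = {(\<lambda>f. \<Sum>j<r. c j * Z j q f) | c. True} \<and>
             (\<forall>c. (\<lambda>f. \<Sum>j<r. c j * Z j q f) = vzero \<longrightarrow> (\<forall>j<r. c j = 0))))"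

definition sections_of :: "('m, 'k::finite) chart set \<Rightarrow> ('m \<Rightarrow> 'm cvector set) \<Rightarrow> 'm cfield set" where
  "sections_of A P = {X \<in> fields A. \<forall>p. X p \<in> P p}"

definition formally_integrable :: "('m, 'k::finite) chart set \<Rightarrow> ('m \<Rightarrow> 'm cvector set) \<Rightarrow> bool" where
  "formally_integrable A P \<longleftrightarrow>
     (\<forall>X\<in>sections_of A P. \<forall>Y\<in>sections_of A P. bracket X Y \<in> sections_of A P)"

definition conj_bundle :: "('m \<Rightarrow> 'm cvector set) \<Rightarrow> 'm \<Rightarrow> 'm cvector set" where
  "conj_bundle P p = vcnj ` P p"

definition complexification :: "('m \<Rightarrow> 'm cvector set) \<Rightarrow> 'm \<Rightarrow> 'm cvector set" where
  "complexification E p = {vadd v (vscale \<i> w) | v w. v \<in> E p \<and> w \<in> E p}"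

section \<open>Differential forms\<close>

text \<open>A real one-form is stored as its complex-linear extension to the complexified tangent spaces;
  its values outside \<open>ctangent A p\<close> are irrelevant.\<close>

definition real_one_form :: "('m, 'k::finite) chart set \<Rightarrow> ('m \<Rightarrow> 'm cvector \<Rightarrow> complex) \<Rightarrow> bool" where
  "real_one_form A \<theta> \<longleftrightarrow>
     (\<forall>p. \<forall>v\<in>ctangent A p. (\<forall>w\<in>ctangent A p. \<theta> p (vadd v w) = \<theta> p v + \<theta> p w) \<and>
        (\<forall>c. \<theta> p (vscale c v) = c * \<theta> p v) \<and> \<theta> p (vcnj v) = cnj (\<theta> p v)) \<and>
     (\<forall>X\<in>fields A. smooth_fun A (\<lambda>p. \<theta> p (X p)))"

text \<open>Pointwise value of \<open>d\<theta>\<close> (normalised without a factor \<open>1/2\<close>). The right-hand side of Cartan's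
  formula depends only on \<open>X p\<close> and \<open>Y p\<close>, and every vector extends to a smooth field.\<close>

definition ext_d :: "('m, 'k::finite) chart set \<Rightarrow> ('m \<Rightarrow> 'm cvector \<Rightarrow> complex) \<Rightarrow>
    'm \<Rightarrow> 'm cvector \<Rightarrow> 'm cvector \<Rightarrow> complex" where
  "ext_d A \<theta> p v w = (THE c. \<forall>X\<in>fields A. \<forall>Y\<in>fields A. X p = v \<longrightarrow> Y p = w \<longrightarrow>
     c = X p (\<lambda>q. \<theta> q (Y q)) - Y p (\<lambda>q. \<theta> q (X q)) - \<theta> p (bracket X Y p))"

text \<open>The value of \<open>\<theta> \<and> (d\<theta>)\<^sup>n / n!\<close> on \<open>v 0, \<dots>, v (2 n)\<close>; the factor \<open>2\<^sup>n\<close> is the one in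
  \<open>\<alpha> \<and> \<beta> = (1 / (p! q!)) \<Sum>\<sigma> sgn \<sigma> (\<alpha> \<otimes> \<beta>) \<circ> \<sigma>\<close>.\<close>

definition contact_volume_form :: "('m, 'k::finite) chart set \<Rightarrow> nat \<Rightarrow>
    ('m \<Rightarrow> 'm cvector \<Rightarrow> complex) \<Rightarrow> 'm \<Rightarrow> (nat \<Rightarrow> 'm cvector) \<Rightarrow> complex" where
  "contact_volume_form A n \<theta> p v =
     (\<Sum>\<sigma> | \<sigma> permutes {..<2*n+1}. of_int (sign \<sigma>) * \<theta> p (v (\<sigma> 0)) *
        (\<Prod>j<n. ext_d A \<theta> p (v (\<sigma> (2*j+1))) (v (\<sigma> (2*j+2))))) / (2 ^ n * fact n)"

definition contact_form ::
  "('m, 'k::finite) chart set \<Rightarrow> nat \<Rightarrow> ('m \<Rightarrow> 'm cvector \<Rightarrow> complex) \<Rightarrow> bool" where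
  "contact_form A n \<theta> \<longleftrightarrow> real_one_form A \<theta> \<and>
     (\<forall>p. \<exists>v. (\<forall>j. v j \<in> rtangent A p) \<and> contact_volume_form A n \<theta> p v \<noteq> 0)"

definition reeb :: "('m, 'k::finite) chart set \<Rightarrow> ('m \<Rightarrow> 'm cvector \<Rightarrow> complex) \<Rightarrow> 'm cfield" where
  "reeb A \<theta> p = (THE v. v \<in> rtangent A p \<and> \<theta> p v = 1 \<and> (\<forall>w\<in>ctangent A p. ext_d A \<theta> p v w = 0))"

section \<open>CR manifolds\<close>

definition cr_structure ::
  "('m::topological_space, 'k::finite) chart set \<Rightarrow> nat \<Rightarrow> ('m \<Rightarrow> 'm cvector set) \<Rightarrow> bool" where
  "cr_structure A n E10 \<longleftrightarrow>
     subbundle A n E10 \<and> (\<forall>p. E10 p \<inter> conj_bundle E10 p = {vzero}) \<and> formally_integrable A E10"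

definition levi_distribution :: "('m \<Rightarrow> 'm cvector set) \<Rightarrow> 'm \<Rightarrow> 'm cvector set" where
  "levi_distribution E10 p = {vadd v (vcnj v) | v. v \<in> E10 p}"

text \<open>\<open>J\<close> is \<open>\<i>\<close> on \<open>E\<^sub>1\<^sub>,\<^sub>0\<close>, \<open>-\<i>\<close> on its conjugate and \<open>0\<close> on the Reeb field.\<close>

definition cr_J :: "('m, 'k::finite) chart set \<Rightarrow> ('m \<Rightarrow> 'm cvector set) \<Rightarrow>
    ('m \<Rightarrow> 'm cvector \<Rightarrow> complex) \<Rightarrow> 'm \<Rightarrow> 'm cvector \<Rightarrow> 'm cvector" where
  "cr_J A E10 \<theta> p v = (THE u. \<exists>a\<in>E10 p. \<exists>b\<in>conj_bundle E10 p. \<exists>c.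
     v = vadd (vadd a b) (vscale c (reeb A \<theta> p)) \<and> u = vadd (vscale \<i> a) (vscale (- \<i>) b))"

text \<open>On real vectors the expression below is real; \<open>Re\<close> only changes the type.\<close>

definition g_form :: "('m, 'k::finite) chart set \<Rightarrow> ('m \<Rightarrow> 'm cvector set) \<Rightarrow>
    ('m \<Rightarrow> 'm cvector \<Rightarrow> complex) \<Rightarrow> 'm \<Rightarrow> 'm cvector \<Rightarrow> 'm cvector \<Rightarrow> real" where
  "g_form A E10 \<theta> p v w = Re (ext_d A \<theta> p (cr_J A E10 \<theta> p v) w + \<theta> p v * \<theta> p w)"

definition riemannian_metric ::
  "('m, 'k::finite) chart set \<Rightarrow> ('m \<Rightarrow> 'm cvector \<Rightarrow> 'm cvector \<Rightarrow> real) \<Rightarrow> bool" where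
  "riemannian_metric A g \<longleftrightarrow>
     (\<forall>p. \<forall>u\<in>rtangent A p. \<forall>v\<in>rtangent A p.
        (\<forall>w\<in>rtangent A p. g p (vadd u v) w = g p u w + g p v w) \<and>
        (\<forall>r. g p (vscale (complex_of_real r) u) v = r * g p u v) \<and>
        g p u v = g p v u \<and> (u \<noteq> vzero \<longrightarrow> g p u u > 0)) \<and>
     (\<forall>X\<in>real_fields A. \<forall>Y\<in>real_fields A. smooth_fun A (\<lambda>p. g p (X p) (Y p)))"

definition strongly_pseudoconvex_CR :: "('m::topological_space, 'k::finite) chart set \<Rightarrow> nat \<Rightarrow>
    ('m \<Rightarrow> 'm cvector set) \<Rightarrow> ('m \<Rightarrow> 'm cvector \<Rightarrow> complex) \<Rightarrow> bool" where
  "strongly_pseudoconvex_CR A n E10 \<theta> \<longleftrightarrow>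
     smooth_atlas A \<and> CARD('k) = 2 * n + 1 \<and> cr_structure A n E10 \<and> contact_form A n \<theta> \<and>
     (\<forall>p. levi_distribution E10 p = {v \<in> rtangent A p. \<theta> p v = 0}) \<and>
     riemannian_metric A (g_form A E10 \<theta>)"

definition cr_polarization :: "('m::topological_space, 'k::finite) chart set \<Rightarrow> ('m \<Rightarrow> 'm cvector set) \<Rightarrow>
    ('m \<Rightarrow> 'm cvector \<Rightarrow> 'm cvector \<Rightarrow> complex) \<Rightarrow> ('m \<Rightarrow> 'm cvector set) \<Rightarrow> bool" where
  "cr_polarization A E \<Omega> P \<longleftrightarrow>
     (\<exists>r. subbundle A r P) \<and> (\<forall>p. \<forall>v\<in>P p. \<forall>w\<in>P p. \<Omega> p v w = 0) \<and> formally_integrable A P \<and>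
     (\<forall>p. P p \<inter> conj_bundle P p = {vzero}) \<and>
     (\<forall>p. {vadd v w | v w. v \<in> P p \<and> w \<in> conj_bundle P p} = complexification E p)"

section \<open>The trivial line bundle\<close>

type_synonym 'm lsection = "'m \<Rightarrow> 'm \<times> complex"

definition lsections :: "'m lsection set" where
  "lsections = {s. \<forall>x. fst (s x) = x}"

definition smooth_lsections :: "('m, 'k::finite) chart set \<Rightarrow> 'm lsection set" where
  "smooth_lsections A = {s \<in> lsections. smooth_fun A (\<lambda>x. snd (s x))}"

definition lzero :: "'m lsection" where
  "lzero = (\<lambda>x. (x, 0))"

definition ladd :: "'m lsection \<Rightarrow> 'm lsection \<Rightarrow> 'm lsection" where
  "ladd s t = (\<lambda>x. (x, snd (s x) + snd (t x)))"

definition lscale :: "('m \<Rightarrow> complex) \<Rightarrow> 'm lsection \<Rightarrow> 'm lsection" where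
  "lscale f s = (\<lambda>x. (x, f x * snd (s x)))"

text \<open>Hermitian metrics and connections are over the fixed bundle \<open>M \<times> \<complex>\<close>. \<open>h x\<close> is only used on pairs of
  elements of the fibre over \<open>x\<close>; connections are extended complex-linearly to complex fields.\<close>

definition hermitian_metric :: "('m, 'k::finite) chart set \<Rightarrow>
    ('m \<Rightarrow> 'm \<times> complex \<Rightarrow> 'm \<times> complex \<Rightarrow> complex) \<Rightarrow> bool" where
  "hermitian_metric A h \<longleftrightarrow>
     (\<forall>x z1 z2 w. h x (x, z1 + z2) (x, w) = h x (x, z1) (x, w) + h x (x, z2) (x, w)) \<and>
     (\<forall>x c z w. h x (x, c * z) (x, w) = c * h x (x, z) (x, w)) \<and>
     (\<forall>x z w. h x (x, w) (x, z) = cnj (h x (x, z) (x, w))) \<and>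
     (\<forall>x z. z \<noteq> 0 \<longrightarrow> Re (h x (x, z) (x, z)) > 0) \<and>
     (\<forall>s\<in>smooth_lsections A. \<forall>t\<in>smooth_lsections A. smooth_fun A (\<lambda>x. h x (s x) (t x)))"

definition connection :: "('m, 'k::finite) chart set \<Rightarrow> ('m cfield \<Rightarrow> 'm lsection \<Rightarrow> 'm lsection) \<Rightarrow> bool" where
  "connection A D \<longleftrightarrow> (\<forall>X\<in>fields A. \<forall>s\<in>smooth_lsections A.
     D X s \<in> smooth_lsections A \<and>
     (\<forall>Y\<in>fields A. D (\<lambda>p. vadd (X p) (Y p)) s = ladd (D X s) (D Y s)) \<and>
     (\<forall>t\<in>smooth_lsections A. D X (ladd s t) = ladd (D X s) (D X t)) \<and>
     (\<forall>f. smooth_fun A f \<longrightarrow> D (\<lambda>p. vscale (f p) (X p)) s = lscale f (D X s) \<and>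
        D X (lscale f s) = ladd (lscale (\<lambda>p. X p f) s) (lscale f (D X s))))"

definition metric_connection :: "('m, 'k::finite) chart set \<Rightarrow>
    ('m \<Rightarrow> 'm \<times> complex \<Rightarrow> 'm \<times> complex \<Rightarrow> complex) \<Rightarrow> ('m cfield \<Rightarrow> 'm lsection \<Rightarrow> 'm lsection) \<Rightarrow> bool" where
  "metric_connection A h D \<longleftrightarrow> connection A D \<and>
     (\<forall>X\<in>real_fields A. \<forall>s\<in>smooth_lsections A. \<forall>t\<in>smooth_lsections A. \<forall>p.
        X p (\<lambda>x. h x (s x) (t x)) = h p (D X s p) (t p) + h p (s p) (D X t p))"

definition curvature :: "('m cfield \<Rightarrow> 'm lsection \<Rightarrow> 'm lsection) \<Rightarrow>
    'm cfield \<Rightarrow> 'm cfield \<Rightarrow> 'm lsection \<Rightarrow> 'm lsection" where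
  "curvature D X Y s =
     (\<lambda>x. (x, snd (D X (D Y s) x) - snd (D Y (D X s) x) - snd (D (bracket X Y) s x)))"

definition quantum_bundle :: "('m, 'k::finite) chart set \<Rightarrow> ('m \<Rightarrow> 'm cvector set) \<Rightarrow>
    ('m \<Rightarrow> 'm cvector \<Rightarrow> 'm cvector \<Rightarrow> complex) \<Rightarrow>
    ('m \<Rightarrow> 'm \<times> complex \<Rightarrow> 'm \<times> complex \<Rightarrow> complex) \<Rightarrow> ('m cfield \<Rightarrow> 'm lsection \<Rightarrow> 'm lsection) \<Rightarrow> bool" where
  "quantum_bundle A E \<Omega> h D \<longleftrightarrow> hermitian_metric A h \<and> metric_connection A h D \<and>
     (\<forall>X\<in>real_fields A. \<forall>Y\<in>real_fields A. \<forall>s\<in>smooth_lsections A. \<forall>p.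
        X p \<in> E p \<longrightarrow> Y p \<in> E p \<longrightarrow> curvature D X Y s p = (p, \<i> * \<Omega> p (X p) (Y p) * snd (s p)))"

definition triv_h :: "'m \<Rightarrow> 'm \<times> complex \<Rightarrow> 'm \<times> complex \<Rightarrow> complex" where
  "triv_h x u w = snd u * cnj (snd w)"

definition triv_conn :: "('m \<Rightarrow> 'm cvector \<Rightarrow> complex) \<Rightarrow> 'm cfield \<Rightarrow> 'm lsection \<Rightarrow> 'm lsection" where
  "triv_conn \<theta> X s = (\<lambda>x. (x, X x (\<lambda>y. snd (s y)) - \<i> * \<theta> x (X x) * snd (s x)))"

definition polarized :: "('m, 'k::finite) chart set \<Rightarrow> ('m \<Rightarrow> 'm cvector set) \<Rightarrow>
    ('m cfield \<Rightarrow> 'm lsection \<Rightarrow> 'm lsection) \<Rightarrow> 'm lsection \<Rightarrow> bool" where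
  "polarized A P D s \<longleftrightarrow> (\<forall>Z\<in>sections_of A P. D (\<lambda>p. vcnj (Z p)) s = lzero)"

section \<open>The tangential Cauchy--Riemann operators\<close>

text \<open>The dual of \<open>E\<^sub>0\<^sub>,\<^sub>1\<close> at \<open>x\<close> is represented by functions on \<open>'m cvector\<close> vanishing outside
  \<open>conj_bundle E10 x\<close>. Since the line bundle has fibre \<open>{x} \<times> \<complex>\<close>, its tensor product with this dual has
  fibre \<open>{x} \<times>\<close> (the dual).\<close>

definition dbar_b :: "('m \<Rightarrow> 'm cvector set) \<Rightarrow> ('m \<Rightarrow> complex) \<Rightarrow> 'm \<Rightarrow> 'm cvector \<Rightarrow> complex" where
  "dbar_b E10 f x = (\<lambda>w. if w \<in> conj_bundle E10 x then w f else 0)"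

definition dbar_L :: "('m \<Rightarrow> 'm cvector set) \<Rightarrow> 'm lsection \<Rightarrow> 'm \<Rightarrow> 'm \<times> ('m cvector \<Rightarrow> complex)" where
  "dbar_L E10 s = (\<lambda>x. (x, dbar_b E10 (\<lambda>y. snd (s y)) x))"

definition dual_zero :: "'m \<Rightarrow> 'm \<times> ('m cvector \<Rightarrow> complex)" where
  "dual_zero = (\<lambda>x. (x, \<lambda>w. 0))"

section \<open>The measure of \<open>\<theta> \<and> (d\<theta>)\<^sup>n / n!\<close>\<close>

text \<open>\<open>M\<close> is oriented by \<open>\<theta> \<and> (d\<theta>)\<^sup>n\<close>, so in a chart the measure has as Lebesgue density the absolute
  value of the form on the coordinate frame (whose enumeration is then irrelevant).\<close>

definition chart_volume :: "('m::topological_space, 'k::finite) chart set \<Rightarrow> nat \<Rightarrow>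
    ('m \<Rightarrow> 'm cvector \<Rightarrow> complex) \<Rightarrow> ('m, 'k) chart \<Rightarrow> 'm measure" where
  "chart_volume A n \<theta> = (\<lambda>(U, \<phi>). distr
     (density (restrict_space lborel (\<phi> ` U)) (\<lambda>y. ennreal (cmod
        (let p = inv_into U \<phi> y in
           contact_volume_form A n \<theta> p (\<lambda>j. coord_vec A (U, \<phi>) p (from_nat_into UNIV j))))))
     borel (inv_into U \<phi>))"

text \<open>The global measure is assembled, on compact \<open>M\<close>, from a finite cover by compact subsets of chart
  domains made disjoint. By the change of variables formula it does not depend on the cover chosen.\<close>

definition compact_chart_cover ::
  "('m::topological_space, 'k::finite) chart set \<Rightarrow> (('m, 'k) chart \<times> 'm set) list \<Rightarrow> bool" where
  "compact_chart_cover A cs \<longleftrightarrow>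
     (\<forall>(c, K)\<in>set cs. c \<in> A \<and> compact K \<and> K \<subseteq> fst c) \<and> (\<Union>(c, K)\<in>set cs. K) = UNIV"

definition contact_measure :: "('m::topological_space, 'k::finite) chart set \<Rightarrow> nat \<Rightarrow>
    ('m \<Rightarrow> 'm cvector \<Rightarrow> complex) \<Rightarrow> 'm measure" where
  "contact_measure A n \<theta> = (let cs = (SOME cs. compact_chart_cover A cs) in
     measure_of UNIV (sets borel) (\<lambda>B. \<Sum>i<length cs.
       emeasure (chart_volume A n \<theta> (fst (cs ! i))) (B \<inter> (snd (cs ! i) - (\<Union>j<i. snd (cs ! j))))))"

section \<open>Square integrable sections and functions\<close>

definition section_inner :: "'m measure \<Rightarrow> ('m \<Rightarrow> 'm \<times> complex \<Rightarrow> 'm \<times> complex \<Rightarrow> complex) \<Rightarrow>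
    'm lsection \<Rightarrow> 'm lsection \<Rightarrow> complex" where
  "section_inner \<mu> h s t = (LINT x|\<mu>. h x (s x) (t x))"

definition function_inner :: "'m measure \<Rightarrow> ('m \<Rightarrow> complex) \<Rightarrow> ('m \<Rightarrow> complex) \<Rightarrow> complex" where
  "function_inner \<mu> f g = (LINT x|\<mu>. f x * cnj (g x))"

definition L2_sections :: "'m measure \<Rightarrow> ('m \<Rightarrow> 'm \<times> complex \<Rightarrow> 'm \<times> complex \<Rightarrow> complex) \<Rightarrow> 'm lsection set" where
  "L2_sections \<mu> h =
     {s \<in> lsections. (\<lambda>x. snd (s x)) \<in> borel_measurable \<mu> \<and> integrable \<mu> (\<lambda>x. h x (s x) (s x))}"

definition L2_functions :: "'m measure \<Rightarrow> ('m \<Rightarrow> complex) set" where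
  "L2_functions \<mu> = {f \<in> borel_measurable \<mu>. integrable \<mu> (\<lambda>x. (cmod (f x))\<^sup>2)}"

text \<open>Elements of the \<open>L\<^sup>2\<close> spaces proper are classes modulo equality almost everywhere.\<close>

definition ae_class :: "'m measure \<Rightarrow> ('m \<Rightarrow> 'b) set \<Rightarrow> ('m \<Rightarrow> 'b) \<Rightarrow> ('m \<Rightarrow> 'b) set" where
  "ae_class \<mu> V s = {t \<in> V. AE x in \<mu>. t x = s x}"

definition class_add :: "'m measure \<Rightarrow> ('m \<Rightarrow> 'b) set \<Rightarrow> (('m \<Rightarrow> 'b) \<Rightarrow> ('m \<Rightarrow> 'b) \<Rightarrow> 'm \<Rightarrow> 'b) \<Rightarrow>
    ('m \<Rightarrow> 'b) set \<Rightarrow> ('m \<Rightarrow> 'b) set \<Rightarrow> ('m \<Rightarrow> 'b) set" where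
  "class_add \<mu> V add a b = (\<Union>s\<in>a. \<Union>t\<in>b. ae_class \<mu> V (add s t))"

definition class_scale :: "'m measure \<Rightarrow> ('m \<Rightarrow> 'b) set \<Rightarrow> (complex \<Rightarrow> ('m \<Rightarrow> 'b) \<Rightarrow> 'm \<Rightarrow> 'b) \<Rightarrow>
    complex \<Rightarrow> ('m \<Rightarrow> 'b) set \<Rightarrow> ('m \<Rightarrow> 'b) set" where
  "class_scale \<mu> V scl c a = (\<Union>s\<in>a. ae_class \<mu> V (scl c s))"

definition class_inner :: "('s \<Rightarrow> 's \<Rightarrow> complex) \<Rightarrow> 's set \<Rightarrow> 's set \<Rightarrow> complex" where
  "class_inner ip a b = ip (SOME s. s \<in> a) (SOME t. t \<in> b)"

text \<open>\<open>D u = 0\<close> in the sense of distributions, for a differential operator \<open>D\<close> on the smooth objects \<open>T\<close>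
  over the closed manifold \<open>M\<close>: \<open>\<langle>u, D\<^sup>* t\<rangle> = 0\<close> for every \<open>t\<close> in \<open>T\<close>, with \<open>D\<^sup>*\<close> the formal adjoint. Below
  \<open>t'\<close> is \<open>D\<^sup>* t\<close>, given by its defining property.\<close>

definition distributional_zero :: "'s set \<Rightarrow> ('s \<Rightarrow> 's \<Rightarrow> complex) \<Rightarrow> ('s \<Rightarrow> 's) \<Rightarrow> 's \<Rightarrow> bool" where
  "distributional_zero T ip D u \<longleftrightarrow>
     (\<forall>t\<in>T. \<forall>t'\<in>T. (\<forall>s\<in>T. ip (D s) t = ip s t') \<longrightarrow> ip u t' = 0)"

definition L2_polarized :: "('m, 'k::finite) chart set \<Rightarrow> 'm measure \<Rightarrow> ('m \<Rightarrow> 'm cvector set) \<Rightarrow>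
    ('m \<Rightarrow> 'm \<times> complex \<Rightarrow> 'm \<times> complex \<Rightarrow> complex) \<Rightarrow> ('m cfield \<Rightarrow> 'm lsection \<Rightarrow> 'm lsection) \<Rightarrow>
    'm lsection set" where
  "L2_polarized A \<mu> P h D = {s \<in> L2_sections \<mu> h. \<forall>Z\<in>sections_of A P.
     distributional_zero (smooth_lsections A) (section_inner \<mu> h) (D (\<lambda>p. vcnj (Z p))) s}"

text \<open>The equations for the Cauchy--Riemann operators are tested on all smooth sections of the
  conjugate bundle, i.e. component by component.\<close>

definition L2_CR_sections :: "('m, 'k::finite) chart set \<Rightarrow> 'm measure \<Rightarrow> ('m \<Rightarrow> 'm cvector set) \<Rightarrow>
    ('m \<Rightarrow> 'm \<times> complex \<Rightarrow> 'm \<times> complex \<Rightarrow> complex) \<Rightarrow> 'm lsection set" where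
  "L2_CR_sections A \<mu> E10 h = {s \<in> L2_sections \<mu> h. \<forall>W\<in>sections_of A (conj_bundle E10).
     distributional_zero (smooth_lsections A) (section_inner \<mu> h)
       (\<lambda>t x. (x, snd (dbar_L E10 t x) (W x))) s}"

definition L2_CR_functions ::
  "('m, 'k::finite) chart set \<Rightarrow> 'm measure \<Rightarrow> ('m \<Rightarrow> 'm cvector set) \<Rightarrow> ('m \<Rightarrow> complex) set" where
  "L2_CR_functions A \<mu> E10 = {f \<in> L2_functions \<mu>. \<forall>W\<in>sections_of A (conj_bundle E10).
     distributional_zero {g. smooth_fun A g} (function_inner \<mu>) (\<lambda>g x. dbar_b E10 g x (W x)) f}"

text \<open>Isomorphism of complex inner product spaces, each given as a subspace (closed under the operations)
  of an ambient space.\<close>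

definition unitary_iso ::
  "'v set \<Rightarrow> ('v \<Rightarrow> 'v \<Rightarrow> 'v) \<Rightarrow> (complex \<Rightarrow> 'v \<Rightarrow> 'v) \<Rightarrow> ('v \<Rightarrow> 'v \<Rightarrow> complex) \<Rightarrow>
   'w set \<Rightarrow> ('w \<Rightarrow> 'w \<Rightarrow> 'w) \<Rightarrow> (complex \<Rightarrow> 'w \<Rightarrow> 'w) \<Rightarrow> ('w \<Rightarrow> 'w \<Rightarrow> complex) \<Rightarrow> ('v \<Rightarrow> 'w) \<Rightarrow> bool" where
  "unitary_iso V addV sclV ipV W addW sclW ipW F \<longleftrightarrow>
     V \<noteq> {} \<and> (\<forall>a\<in>V. \<forall>b\<in>V. addV a b \<in> V) \<and> (\<forall>c. \<forall>a\<in>V. sclV c a \<in> V) \<and>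
     W \<noteq> {} \<and> (\<forall>a\<in>W. \<forall>b\<in>W. addW a b \<in> W) \<and> (\<forall>c. \<forall>a\<in>W. sclW c a \<in> W) \<and>
     bij_betw F V W \<and>
     (\<forall>a\<in>V. \<forall>b\<in>V. F (addV a b) = addW (F a) (F b) \<and> ipW (F a) (F b) = ipV a b) \<and>
     (\<forall>c. \<forall>a\<in>V. F (sclV c a) = sclW c (F a))"

text \<open>The space \<open>Q(M)\<close> and the space of CR-holomorphic \<open>L\<^sup>2\<close> functions, as sets of classes.\<close>

definition quantum_space :: "('m, 'k::finite) chart set \<Rightarrow> 'm measure \<Rightarrow> ('m \<Rightarrow> 'm cvector set) \<Rightarrow>
    ('m \<Rightarrow> 'm \<times> complex \<Rightarrow> 'm \<times> complex \<Rightarrow> complex) \<Rightarrow> ('m cfield \<Rightarrow> 'm lsection \<Rightarrow> 'm lsection) \<Rightarrow>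
    'm lsection set set" where
  "quantum_space A \<mu> P h D = ae_class \<mu> (L2_sections \<mu> h) ` L2_polarized A \<mu> P h D"

definition CR_function_space :: "('m, 'k::finite) chart set \<Rightarrow> 'm measure \<Rightarrow>
    ('m \<Rightarrow> 'm cvector set) \<Rightarrow> ('m \<Rightarrow> complex) set set" where
  "CR_function_space A \<mu> E10 = ae_class \<mu> (L2_functions \<mu>) ` L2_CR_functions A \<mu> E10"

end

theory Submission
  imports Defs "HOL-Computational_Algebra.Polynomial"
begin

text \<open>Everything rests on one observation: the connection form \<open>- \<i> \<theta>\<close> vanishes on \<open>E10\<close> and on its conjugate, because
  the Levi distribution is the kernel of the real form \<open>\<theta>\<close> (\<open>theta_E10\<close>). Hence differentiating a section along the
  conjugate of a section of \<open>E10\<close> is the same as applying that vector field to the component function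
  (\<open>triv_conn_conj_E10\<close>). For smooth sections this gives the equivalence of polarized and CR-holomorphic, because every
  vector of \<open>E10\<close> extends to a section (\<open>E10_extends_to_section\<close>); for square integrable sections the operators that define
  the two weak equations are literally equal (\<open>L2_polarized_eq_L2_CR_sections\<close>).

  That \<open>E10\<close> is isotropic and that the curvature is \<open>- \<i> d\<theta>\<close> are both read off from Cartan's formula. For this one has to
  know that \<open>ext_d\<close>, a definite description over all extensions of two vectors, is given by Cartan's formula for any pair of
  fields (\<open>ext_d_eq_cartan\<close>), i.e. that the formula is tensorial. This needs a local expansion of fields in coordinate
  vectors. Tangent vectors are derivations of global smooth functions, and the usual proof of such an expansion goes
  through Hadamard's lemma. Here the CR structure gives it by counting dimensions: \<open>E10\<close>, its conjugate and one transverse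
  vector span the tangent space by \<open>2 * n + 1\<close> vectors, and there are as many coordinate vectors, which are independent
  (\<open>ctangent_spanned\<close>, \<open>ctangent_coord_expansion\<close>).

  The unitary isomorphism is composition with \<open>snd\<close>, the inverse of the trivialisation \<open>lsection_of\<close>. Algebraically there
  is nothing to prove, but that the spaces of weak solutions are closed under addition requires test functions to be square
  integrable, hence the contact measure to be finite (\<open>contact_measure_finite\<close>). This holds because the density of the
  measure is continuous in every chart and \<open>M\<close> is covered by finitely many compact subsets of chart domains.\<close>

section \<open>Calculus of smooth functions on open sets\<close>

lemma Ck_on_cong:
  assumes "open S" "\<And>x. x \<in> S \<Longrightarrow> f x = g x" "Ck_on k S f"
  shows "Ck_on k S g"
  using assms(2,3)
proof (induction k arbitrary: f g)
  case 0
  then show ?case by (simp cong: continuous_on_cong)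
next
  case (Suc k)
  have d: "(g has_derivative frechet_derivative f (at x)) (at x)" if "x \<in> S" for x
    using has_derivative_transform_within_open[OF _ \<open>open S\<close> that Suc.prems(1)] Suc.prems(2) that
    by (auto simp: frechet_derivative_works)
  have e: "frechet_derivative f (at x) = frechet_derivative g (at x)" if "x \<in> S" for x
    using frechet_derivative_at[OF d[OF that]] .
  have "Ck_on k S (\<lambda>x. frechet_derivative g (at x) b)" if "b \<in> Basis" for b
    by (rule Suc.IH[of "\<lambda>x. frechet_derivative f (at x) b"]) (use e Suc.prems that in auto)
  with d show ?case by (auto simp: differentiable_def)
qed

text \<open>Every closure property below is an induction on the order of differentiability. This rule carries
  the step: exhibit a derivative \<open>D\<close> and show that its directional components are smooth of one order less.\<close>

lemma Ck_on_SucI: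
  assumes "open S" "\<And>x. x \<in> S \<Longrightarrow> (f has_derivative D x) (at x)"
    and "\<And>b. b \<in> Basis \<Longrightarrow> Ck_on k S (\<lambda>x. D x b)"
  shows "Ck_on (Suc k) S f"
proof -
  have e: "D x = frechet_derivative f (at x)" if "x \<in> S" for x
    using frechet_derivative_at[OF assms(2)[OF that]] .
  have "Ck_on k S (\<lambda>x. frechet_derivative f (at x) b)" if "b \<in> Basis" for b
    by (rule Ck_on_cong[OF assms(1) _ assms(3)[OF that]]) (simp add: e)
  with assms(2) show ?thesis by (auto simp: differentiable_def)
qed

lemma Ck_on_SucD:
  assumes "Ck_on (Suc k) S f"
  shows "x \<in> S \<Longrightarrow> (f has_derivative frechet_derivative f (at x)) (at x)"
    and "b \<in> Basis \<Longrightarrow> Ck_on k S (\<lambda>x. frechet_derivative f (at x) b)"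
  using assms by (auto simp: frechet_derivative_works)

lemma Ck_on_Suc_imp_Ck_on: "Ck_on (Suc k) S f \<Longrightarrow> Ck_on k S f"
proof (induction k arbitrary: f)
  case 0
  then show ?case
    by (auto intro!: continuous_at_imp_continuous_on differentiable_imp_continuous_within)
next
  case (Suc k)
  then show ?case by (auto simp del: Ck_on.simps(1))
qed

lemma Ck_on_subset: "Ck_on k S f \<Longrightarrow> T \<subseteq> S \<Longrightarrow> Ck_on k T f"
  by (induction k arbitrary: f) (auto intro: continuous_on_subset)

lemma Ck_on_local:
  assumes "\<And>x. x \<in> S \<Longrightarrow> \<exists>T. open T \<and> x \<in> T \<and> Ck_on k T f"
  shows "Ck_on k S f"
  using assms
proof (induction k arbitrary: f)
  case 0
  have "continuous (at x) f" if "x \<in> S" for x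
    using 0[OF that] by (auto simp: continuous_on_eq_continuous_at)
  then show ?case by (simp add: continuous_at_imp_continuous_on)
next
  case (Suc k)
  have "f differentiable at x" if "x \<in> S" for x using Suc.prems[OF that] by auto
  moreover have "Ck_on k S (\<lambda>x. frechet_derivative f (at x) b)" if "b \<in> Basis" for b
    by (rule Suc.IH) (use Suc.prems that in fastforce)
  ultimately show ?case by simp
qed

lemma Ck_on_const: "Ck_on k S (\<lambda>x. c)"
  by (induction k arbitrary: c) (auto simp: frechet_derivative_const)

lemma Ck_on_bounded_linear:
  assumes "open S" "bounded_linear L" "Ck_on k S f"
  shows "Ck_on k S (\<lambda>x. L (f x))"
  using assms(3)
proof (induction k arbitrary: f)
  case 0
  then show ?case by (simp add: bounded_linear.continuous_on[OF assms(2)])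
next
  case (Suc k)
  show ?case
  proof (rule Ck_on_SucI[OF assms(1)])
    show "((\<lambda>x. L (f x)) has_derivative (\<lambda>b. L (frechet_derivative f (at x) b))) (at x)"
      if "x \<in> S" for x
      by (rule bounded_linear.has_derivative[OF assms(2) Ck_on_SucD(1)[OF Suc.prems that]])
    show "Ck_on k S (\<lambda>x. L (frechet_derivative f (at x) b))" if "b \<in> Basis" for b
      by (rule Suc.IH[OF Ck_on_SucD(2)[OF Suc.prems that]])
  qed
qed

lemma Ck_on_add:
  assumes "open S" "Ck_on k S f" "Ck_on k S g"
  shows "Ck_on k S (\<lambda>x. f x + g x)"
  using assms(2,3)
proof (induction k arbitrary: f g)
  case 0
  then show ?case by (simp add: continuous_on_add)
next
  case (Suc k)
  show ?case
    by (rule Ck_on_SucI[OF assms(1) has_derivative_add])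
      (use Suc Ck_on_SucD in blast)+
qed

lemma Ck_on_sum:
  assumes "open S" "\<And>i. i \<in> I \<Longrightarrow> Ck_on k S (f i)"
  shows "Ck_on k S (\<lambda>x. \<Sum>i\<in>I. f i x)"
  using assms(2)
  by (induction I rule: infinite_finite_induct) (auto intro: Ck_on_const Ck_on_add[OF assms(1)])

lemma Ck_on_bilinear:
  assumes "open S" "bounded_bilinear B" "Ck_on k S f" "Ck_on k S g"
  shows "Ck_on k S (\<lambda>x. B (f x) (g x))"
  using assms(3,4)
proof (induction k arbitrary: f g)
  case 0
  then show ?case by (simp add: bounded_bilinear.continuous_on[OF assms(2)])
next
  case (Suc k)
  note f = Suc.prems(1) and g = Suc.prems(2)
  show ?case
  proof (rule Ck_on_SucI[OF assms(1)])
    show "((\<lambda>x. B (f x) (g x)) has_derivative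
        (\<lambda>b. B (f x) (frechet_derivative g (at x) b) + B (frechet_derivative f (at x) b) (g x))) (at x)"
      if "x \<in> S" for x
      by (rule bounded_bilinear.FDERIV[OF assms(2) Ck_on_SucD(1)[OF f that] Ck_on_SucD(1)[OF g that]])
    show "Ck_on k S (\<lambda>x. B (f x) (frechet_derivative g (at x) b) + B (frechet_derivative f (at x) b) (g x))"
      if "b \<in> Basis" for b
      by (intro Ck_on_add[OF assms(1)] Suc.IH Ck_on_SucD(2)[OF f that] Ck_on_SucD(2)[OF g that]
          Ck_on_Suc_imp_Ck_on[OF f] Ck_on_Suc_imp_Ck_on[OF g])
  qed
qed

text \<open>The chain rule expresses a directional derivative of \<open>f \<circ> g\<close> through those of \<open>f\<close> and \<open>g\<close> along basis
  vectors, by expanding the derivative of \<open>g\<close> in the basis. The summands are products of functions of one order less,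
  so the induction hypothesis is applied to the partial derivatives of \<open>f\<close>.\<close>

lemma Ck_on_compose:
  fixes g :: "'d::euclidean_space \<Rightarrow> 'e::euclidean_space" and f :: "'e \<Rightarrow> 'b::real_normed_vector"
  assumes "open S" "g ` S \<subseteq> T" "Ck_on k S g" "Ck_on k T f"
  shows "Ck_on k S (\<lambda>x. f (g x))"
  using assms(3,4)
proof (induction k arbitrary: f)
  case 0
  then show ?case using assms(2) by (auto intro: continuous_on_compose2)
next
  case (Suc k)
  note g = Suc.prems(1) and f = Suc.prems(2)
  let ?f' = "\<lambda>x. frechet_derivative f (at x)" and ?g' = "\<lambda>x. frechet_derivative g (at x)"
  have exp: "?f' (g x) (?g' x b) = (\<Sum>e\<in>Basis. (?g' x b \<bullet> e) *\<^sub>R ?f' (g x) e)" if "x \<in> S" for x b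
  proof -
    have l: "linear (?f' (g x))"
      using Ck_on_SucD(1)[OF f] assms(2) that has_derivative_linear by blast
    have "?f' (g x) (?g' x b) = ?f' (g x) (\<Sum>e\<in>Basis. (?g' x b \<bullet> e) *\<^sub>R e)"
      by (simp add: euclidean_representation)
    also have "\<dots> = (\<Sum>e\<in>Basis. (?g' x b \<bullet> e) *\<^sub>R ?f' (g x) e)"
      by (simp add: linear_sum[OF l] linear_cmul[OF l])
    finally show ?thesis .
  qed
  show ?case
  proof (rule Ck_on_SucI[OF assms(1)])
    show "((\<lambda>x. f (g x)) has_derivative (\<lambda>b. ?f' (g x) (?g' x b))) (at x)" if "x \<in> S" for x
      by (rule has_derivative_compose[OF Ck_on_SucD(1)[OF g that]])
        (use Ck_on_SucD(1)[OF f] assms(2) that in auto)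
    show "Ck_on k S (\<lambda>x. ?f' (g x) (?g' x b))" if b: "b \<in> Basis" for b
    proof (rule Ck_on_cong[OF assms(1) exp[symmetric]])
      show "Ck_on k S (\<lambda>x. \<Sum>e\<in>Basis. (?g' x b \<bullet> e) *\<^sub>R ?f' (g x) e)"
        by (intro Ck_on_sum[OF assms(1)] Ck_on_bilinear[OF assms(1) bounded_bilinear_scaleR]
            Ck_on_bounded_linear[OF assms(1) bounded_linear_inner_left] Suc.IH
            Ck_on_SucD(2)[OF g b] Ck_on_SucD(2)[OF f] Ck_on_Suc_imp_Ck_on[OF g])
    qed
  qed
qed

section \<open>Smooth bump functions\<close>

text \<open>For \<open>P = 1\<close> this is the classical function \<open>exp (- 1 / x)\<close> extended by \<open>0\<close>. With an arbitrary polynomial in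
  \<open>1 / x\<close> as prefactor the family becomes closed under differentiation.\<close>

definition flat_exp :: "real poly \<Rightarrow> real \<Rightarrow> real" where
  "flat_exp P x = (if x > 0 then poly P (inverse x) * exp (- inverse x) else 0)"

lemma poly_exp_neg_tendsto_0: "((\<lambda>y. poly P y * exp (- y)) \<longlongrightarrow> (0::real)) at_top"
proof -
  have "((\<lambda>y. \<Sum>i\<le>degree P. coeff P i * (y ^ i / exp y)) \<longlongrightarrow> (\<Sum>i\<le>degree P. coeff P i * 0)) at_top"
    by (intro tendsto_intros tendsto_power_div_exp_0)
  moreover have "(\<Sum>i\<le>degree P. coeff P i * (y ^ i / exp y)) = poly P y * exp (- y)" for y :: real
    by (simp add: poly_altdef exp_minus sum_distrib_right divide_simps)
  ultimately show ?thesis by simp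
qed

text \<open>At the origin the difference quotient is again of the form \<open>poly Q y * exp (- y)\<close> with \<open>y = 1 / x\<close>, and the
  exponential wins.\<close>

lemma flat_exp_has_derivative:
  "(flat_exp P has_field_derivative flat_exp ([:0, 0, 1:] * (P - pderiv P)) x) (at x)"
proof -
  consider "x > 0" | "x < 0" | "x = 0" by linarith
  then show ?thesis
  proof cases
    case 1
    have "((\<lambda>x. poly P (inverse x) * exp (- inverse x)) has_field_derivative
        flat_exp ([:0, 0, 1:] * (P - pderiv P)) x) (at x)"
      using 1 by (auto intro!: derivative_eq_intros DERIV_chain2[OF poly_DERIV]
          simp: flat_exp_def field_simps power2_eq_square)
    then show ?thesis
      by (rule has_field_derivative_transform_within_open[where S = "{0<..}"])
        (use 1 in \<open>auto simp: flat_exp_def\<close>)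
  next
    case 2
    have "((\<lambda>x. 0) has_field_derivative flat_exp ([:0, 0, 1:] * (P - pderiv P)) x) (at x)"
      using 2 by (simp add: flat_exp_def)
    then show ?thesis
      by (rule has_field_derivative_transform_within_open[where S = "{..<0}"])
        (use 2 in \<open>auto simp: flat_exp_def\<close>)
  next
    case 3
    have "((\<lambda>y. inverse y * (poly P (inverse y) * exp (- inverse y))) \<longlongrightarrow> 0) (at_right (0::real))"
      using filterlim_compose[OF poly_exp_neg_tendsto_0[of "[:0, 1:] * P"] filterlim_inverse_at_top_right]
      by (simp add: mult.assoc)
    then have "((\<lambda>y. flat_exp P y / y) \<longlongrightarrow> 0) (at_right 0)"
      by (rule Lim_transform_eventually)
        (auto simp: flat_exp_def eventually_at_right_less field_simps intro!: eventually_at_rightI[of 0 1])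
    moreover have "((\<lambda>y. flat_exp P y / y) \<longlongrightarrow> 0) (at_left 0)"
      by (rule Lim_transform_eventually[OF tendsto_const])
        (auto simp: flat_exp_def intro!: eventually_at_leftI[of "-1" 0])
    ultimately have "((\<lambda>y. flat_exp P y / y) \<longlongrightarrow> 0) (at 0)"
      by (simp add: filterlim_at_split)
    then show ?thesis using 3 by (simp add: has_field_derivative_iff flat_exp_def)
  qed
qed

lemma Ck_on_flat_exp: "Ck_on k UNIV (flat_exp P)"
proof (induction k arbitrary: P)
  case 0
  then show ?case
    using flat_exp_has_derivative[of P] DERIV_isCont by (auto intro!: continuous_at_imp_continuous_on)
next
  case (Suc k)
  show ?case
    by (rule Ck_on_SucI[OF open_UNIV flat_exp_has_derivative[unfolded has_field_derivative_def]])
      (use Suc in \<open>simp add: mult.commute\<close>)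
qed

text \<open>The function \<open>exp (- 1 / (r\<^sup>2 - |x - c|\<^sup>2))\<close>, normalised at the centre. Only the value at the centre is
  prescribed, so arguments that localise with it carry its powers as explicit factors instead of relying on a plateau.\<close>

lemma smooth_bump_exists:
  fixes c :: "'e::euclidean_space"
  assumes "r > 0"
  obtains \<beta> :: "'e \<Rightarrow> real"
  where "smooth_on UNIV \<beta>" "\<beta> c = 1" "\<And>x. \<beta> x \<noteq> 0 \<Longrightarrow> dist c x < r"
proof
  let ?\<rho> = "\<lambda>x. r\<^sup>2 - (x - c) \<bullet> (x - c)"
  let ?h = "\<lambda>x. flat_exp 1 (?\<rho> x)"
  have "Ck_on k UNIV (\<lambda>x::'e. x)" for k
    by (induction k) (auto simp: frechet_derivative_ident Ck_on_const)
  then have "Ck_on k UNIV (\<lambda>x. x - c)" for k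
    using Ck_on_add[OF open_UNIV, of k "\<lambda>x. x" "\<lambda>x. - c"] by (simp add: Ck_on_const)
  then have "Ck_on k UNIV (\<lambda>x. (x - c) \<bullet> (x - c))" for k
    by (intro Ck_on_bilinear[OF open_UNIV bounded_bilinear_inner])
  then have "Ck_on k UNIV (\<lambda>x. - ((x - c) \<bullet> (x - c)))" for k
    by (intro Ck_on_bounded_linear[OF open_UNIV bounded_linear_minus[OF bounded_linear_ident]])
  then have "Ck_on k UNIV ?\<rho>" for k
    using Ck_on_add[OF open_UNIV Ck_on_const, of k "\<lambda>x. - ((x - c) \<bullet> (x - c))" "r\<^sup>2"] by simp
  then have "Ck_on k UNIV ?h" for k
    by (intro Ck_on_compose[OF open_UNIV _ _ Ck_on_flat_exp]) auto
  then have "Ck_on k UNIV (\<lambda>x. ?h x / ?h c)" for k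
    by (rule Ck_on_bounded_linear[OF open_UNIV bounded_linear_divide])
  then show "smooth_on UNIV (\<lambda>x. ?h x / ?h c)" by (simp add: smooth_on_def)
  show "?h c / ?h c = 1" using assms by (simp add: flat_exp_def)
  fix x assume "?h x / ?h c \<noteq> 0"
  then have "(x - c) \<bullet> (x - c) < r\<^sup>2" by (auto simp: flat_exp_def split: if_splits)
  then have "norm (x - c) < r"
    using assms by (simp add: power2_norm_eq_inner[symmetric] power2_less_imp_less)
  then show "dist c x < r" by (simp add: dist_norm norm_minus_commute)
qed

section \<open>Smooth functions on a manifold\<close>

lemma smooth_on_compose:
  assumes "open S" "g ` S \<subseteq> T" "smooth_on S g" "smooth_on T f"
  shows "smooth_on S (\<lambda>x. f (g x))"
  using assms(3,4) Ck_on_compose[OF assms(1,2)] unfolding smooth_on_def by blast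

lemma smooth_atlas_chart:
  assumes "smooth_atlas A" "(U, \<phi>) \<in> A"
  shows "open U" "open (\<phi> ` U)" "inj_on \<phi> U" "homeomorphism U (\<phi> ` U) \<phi> (inv_into U \<phi>)"
  using assms by (auto simp: smooth_atlas_def is_chart_def)

lemma smooth_atlas_covers:
  assumes "smooth_atlas A"
  obtains U \<phi> where "(U, \<phi>) \<in> A" "p \<in> U"
proof -
  have "p \<in> (\<Union>c\<in>A. fst c)" using assms by (simp add: smooth_atlas_def)
  then show thesis using that by auto
qed

text \<open>Smoothness on \<open>W\<close> is tested on \<open>\<phi> ` (U \<inter> W)\<close>; openness of this set is what makes the calculus on open subsets of
  Euclidean space applicable.\<close>

lemma open_chart_image:
  assumes "smooth_atlas A" "(U, \<phi>) \<in> A" "open W"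
  shows "open (\<phi> ` (U \<inter> W))"
proof -
  note c = smooth_atlas_chart[OF assms(1,2)]
  have "openin (top_of_set (\<phi> ` U)) (\<phi> ` (U \<inter> W))"
    by (rule homeomorphism_imp_open_map[OF c(4)]) (simp add: assms(3) openin_open_Int)
  with c(2) show ?thesis using openin_open_trans by blast
qed

lemma smooth_fun_onD:
  assumes "smooth_fun_on A W f" "(U, \<phi>) \<in> A"
  shows "Ck_on k (\<phi> ` (U \<inter> W)) (\<lambda>y. f (inv_into U \<phi> y))"
  using assms by (auto simp: smooth_fun_on_def smooth_on_def o_def)

lemma smooth_fun_onI:
  assumes "\<And>U \<phi> k. (U, \<phi>) \<in> A \<Longrightarrow> Ck_on k (\<phi> ` (U \<inter> W)) (\<lambda>y. f (inv_into U \<phi> y))"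
  shows "smooth_fun_on A W f"
  using assms by (auto simp: smooth_fun_on_def smooth_on_def o_def)

lemma smooth_fun_on_const: "smooth_fun_on A W (\<lambda>p. c)"
  by (rule smooth_fun_onI) (rule Ck_on_const)

lemma smooth_fun_on_bounded_linear:
  assumes "smooth_atlas A" "open W" "bounded_linear L" "smooth_fun_on A W f"
  shows "smooth_fun_on A W (\<lambda>p. L (f p))"
  by (rule smooth_fun_onI)
    (rule Ck_on_bounded_linear[OF open_chart_image[OF assms(1) _ assms(2)] assms(3) smooth_fun_onD[OF assms(4)]])

lemma smooth_fun_on_bilinear:
  assumes "smooth_atlas A" "open W" "bounded_bilinear B" "smooth_fun_on A W f" "smooth_fun_on A W g"
  shows "smooth_fun_on A W (\<lambda>p. B (f p) (g p))"
  by (rule smooth_fun_onI)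
    (rule Ck_on_bilinear[OF open_chart_image[OF assms(1) _ assms(2)] assms(3)
      smooth_fun_onD[OF assms(4)] smooth_fun_onD[OF assms(5)]])

lemma smooth_fun_on_add:
  assumes "smooth_atlas A" "open W" "smooth_fun_on A W f" "smooth_fun_on A W g"
  shows "smooth_fun_on A W (\<lambda>p. f p + g p)"
  by (rule smooth_fun_onI)
    (rule Ck_on_add[OF open_chart_image[OF assms(1) _ assms(2)] smooth_fun_onD[OF assms(3)] smooth_fun_onD[OF assms(4)]])

lemma smooth_fun_on_sum:
  assumes "smooth_atlas A" "open W" "\<And>i. i \<in> I \<Longrightarrow> smooth_fun_on A W (f i)"
  shows "smooth_fun_on A W (\<lambda>p. \<Sum>i\<in>I. f i p)"
  using assms(3)
  by (induction I rule: infinite_finite_induct)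
    (auto intro: smooth_fun_on_const smooth_fun_on_add[OF assms(1,2)])

lemma smooth_fun_on_mult:
  fixes f g :: "'m::topological_space \<Rightarrow> complex"
  assumes "smooth_atlas A" "open W" "smooth_fun_on A W f" "smooth_fun_on A W g"
  shows "smooth_fun_on A W (\<lambda>p. f p * g p)"
  by (rule smooth_fun_on_bilinear[OF assms(1,2) bounded_bilinear_mult assms(3,4)])

lemma smooth_fun_on_cmult:
  fixes f :: "'m::topological_space \<Rightarrow> complex"
  assumes "smooth_atlas A" "open W" "smooth_fun_on A W f"
  shows "smooth_fun_on A W (\<lambda>p. c * f p)"
  by (rule smooth_fun_on_mult[OF assms(1,2) smooth_fun_on_const assms(3)])

lemma smooth_fun_on_diff:
  fixes f g :: "'m::topological_space \<Rightarrow> complex"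
  assumes "smooth_atlas A" "open W" "smooth_fun_on A W f" "smooth_fun_on A W g"
  shows "smooth_fun_on A W (\<lambda>p. f p - g p)"
  using smooth_fun_on_add[OF assms(1-3) smooth_fun_on_cmult[OF assms(1,2,4), of "-1"]] by simp

lemma smooth_fun_on_cnj:
  assumes "smooth_atlas A" "open W" "smooth_fun_on A W f"
  shows "smooth_fun_on A W (\<lambda>p. cnj (f p))"
  by (rule smooth_fun_on_bounded_linear[OF assms(1,2) bounded_linear_cnj assms(3)])

lemma smooth_fun_cnj_iff:
  assumes "smooth_atlas A"
  shows "smooth_fun A (\<lambda>p. cnj (f p)) \<longleftrightarrow> smooth_fun A f"
  using smooth_fun_on_cnj[OF assms open_UNIV, of f] smooth_fun_on_cnj[OF assms open_UNIV, of "\<lambda>p. cnj (f p)"]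
  by auto

lemma smooth_fun_on_subset: "smooth_fun_on A W f \<Longrightarrow> W' \<subseteq> W \<Longrightarrow> smooth_fun_on A W' f"
  by (rule smooth_fun_onI) (rule Ck_on_subset[OF smooth_fun_onD], auto)

lemma smooth_fun_on_cong:
  assumes "smooth_atlas A" "open W" "\<And>p. p \<in> W \<Longrightarrow> f p = g p" "smooth_fun_on A W f"
  shows "smooth_fun_on A W g"
proof (rule smooth_fun_onI)
  fix U \<phi> k assume c: "(U, \<phi>) \<in> A"
  show "Ck_on k (\<phi> ` (U \<inter> W)) (\<lambda>y. g (inv_into U \<phi> y))"
    by (rule Ck_on_cong[OF open_chart_image[OF assms(1) c assms(2)] _ smooth_fun_onD[OF assms(4) c]])
      (use smooth_atlas_chart(3)[OF assms(1) c] assms(3) in auto)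
qed

lemma smooth_fun_on_local:
  assumes "smooth_atlas A" "\<And>p. p \<in> W \<Longrightarrow> \<exists>W'. open W' \<and> p \<in> W' \<and> smooth_fun_on A W' f"
  shows "smooth_fun_on A W f"
proof (rule smooth_fun_onI, rule Ck_on_local)
  fix U \<phi> k y assume c: "(U, \<phi>) \<in> A" and "y \<in> \<phi> ` (U \<inter> W)"
  then obtain p where p: "p \<in> U" "p \<in> W" "y = \<phi> p" by auto
  from assms(2)[OF p(2)] obtain W' where W': "open W'" "p \<in> W'" "smooth_fun_on A W' f" by auto
  show "\<exists>T. open T \<and> y \<in> T \<and> Ck_on k T (\<lambda>y. f (inv_into U \<phi> y))"
    using open_chart_image[OF assms(1) c W'(1)] smooth_fun_onD[OF W'(3) c] p W' by blast
qed

lemma smooth_fun_on_continuous: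
  fixes f :: "'m::t2_space \<Rightarrow> 'b::real_normed_vector"
  assumes "smooth_atlas A" "open W" "smooth_fun_on A W f"
  shows "continuous_on W f"
proof -
  have "continuous (at p) f" if "p \<in> W" for p
  proof -
    obtain U \<phi> where c: "(U, \<phi>) \<in> A" "p \<in> U" by (rule smooth_atlas_covers[OF assms(1)])
    note ch = smooth_atlas_chart[OF assms(1) c(1)]
    have "continuous_on (U \<inter> W) \<phi>"
      using ch(4) by (auto simp: homeomorphism_def intro: continuous_on_subset)
    moreover have "continuous_on (\<phi> ` (U \<inter> W)) (\<lambda>y. f (inv_into U \<phi> y))"
      using smooth_fun_onD[OF assms(3) c(1), of 0] by simp
    ultimately have "continuous_on (U \<inter> W) (\<lambda>q. f (inv_into U \<phi> (\<phi> q)))"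
      using continuous_on_compose2 by blast
    then have "continuous_on (U \<inter> W) f"
      by (rule continuous_on_eq) (use ch(3) in auto)
    then show ?thesis
      using c(2) that ch(1) assms(2) by (simp add: continuous_on_eq_continuous_at open_Int)
  qed
  then show ?thesis by (simp add: continuous_at_imp_continuous_on)
qed

text \<open>Smoothness has to be tested in every chart of the atlas. For a function that is given in one chart this is the
  smoothness of the transition maps.\<close>

lemma smooth_fun_on_chart:
  assumes "smooth_atlas A" "(U, \<phi>) \<in> A" "smooth_on (\<phi> ` U) G"
  shows "smooth_fun_on A U (\<lambda>p. G (\<phi> p))"
proof (rule smooth_fun_onI)
  fix V \<psi> k assume c: "(V, \<psi>) \<in> A"
  have "smooth_on (\<psi> ` (V \<inter> U)) (\<lambda>y. \<phi> (inv_into V \<psi> y))"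
    using assms(1,2) c by (force simp: smooth_atlas_def o_def)
  moreover have "(\<lambda>y. \<phi> (inv_into V \<psi> y)) ` \<psi> ` (V \<inter> U) \<subseteq> \<phi> ` U"
    using smooth_atlas_chart(3)[OF assms(1) c] by auto
  ultimately have "smooth_on (\<psi> ` (V \<inter> U)) (\<lambda>y. G (\<phi> (inv_into V \<psi> y)))"
    using smooth_on_compose[OF open_chart_image[OF assms(1) c smooth_atlas_chart(1)[OF assms(1,2)]] _ _ assms(3)]
    by blast
  then show "Ck_on k (\<psi> ` (V \<inter> U)) (\<lambda>y. G (\<phi> (inv_into V \<psi> y)))"
    by (simp add: smooth_on_def)
qed

text \<open>The open sets \<open>W\<close> and \<open>- K\<close> cover \<open>M\<close>, and the function is \<open>0\<close> on the second one.\<close>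

lemma smooth_fun_zero_extension:
  assumes "smooth_atlas A" "open W" "closed K" "K \<subseteq> W" "smooth_fun_on A W f" "\<And>p. p \<notin> K \<Longrightarrow> f p = 0"
  shows "smooth_fun A f"
proof (rule smooth_fun_on_local[OF assms(1)])
  fix p
  have "smooth_fun_on A (- K) f"
    by (rule smooth_fun_on_cong[OF assms(1) _ _ smooth_fun_on_const]) (use assms in auto)
  then show "\<exists>W'. open W' \<and> p \<in> W' \<and> smooth_fun_on A W' f"
    using assms by (cases "p \<in> K") blast+
qed

text \<open>The support \<open>K\<close> is compact in a chart domain, hence closed because \<open>M\<close> is Hausdorff.\<close>

lemma manifold_bump:
  fixes A :: "('m::t2_space, 'k::finite) chart set" and p :: 'm
  assumes "smooth_atlas A" "open W" "p \<in> W"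
  obtains \<eta> :: "'m \<Rightarrow> complex" and K
  where "smooth_fun A \<eta>" "\<eta> p = 1" "closed K" "K \<subseteq> W" "\<And>q. q \<notin> K \<Longrightarrow> \<eta> q = 0"
proof -
  obtain U \<phi> where c: "(U, \<phi>) \<in> A" "p \<in> U" by (rule smooth_atlas_covers[OF assms(1)])
  note ch = smooth_atlas_chart[OF assms(1) c(1)]
  have "\<phi> p \<in> \<phi> ` (U \<inter> W)" using c assms by auto
  then obtain r where r: "r > 0" "cball (\<phi> p) r \<subseteq> \<phi> ` (U \<inter> W)"
    using open_chart_image[OF assms(1) c(1) assms(2)] open_contains_cball by blast
  obtain \<beta> :: "real ^ 'k \<Rightarrow> real"
    where \<beta>: "smooth_on UNIV \<beta>" "\<beta> (\<phi> p) = 1" "\<And>x. \<beta> x \<noteq> 0 \<Longrightarrow> dist (\<phi> p) x < r"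
    by (rule smooth_bump_exists[OF r(1), of "\<phi> p"]) blast
  define \<eta> where "\<eta> q = (if q \<in> U then complex_of_real (\<beta> (\<phi> q)) else 0)" for q
  define K where "K = inv_into U \<phi> ` cball (\<phi> p) r"
  have "cball (\<phi> p) r \<subseteq> \<phi> ` U" using r by auto
  then have "continuous_on (cball (\<phi> p) r) (inv_into U \<phi>)"
    using ch(4) continuous_on_subset by (auto simp: homeomorphism_def)
  then have K: "closed K" unfolding K_def by (intro compact_imp_closed compact_continuous_image) auto
  have "inv_into U \<phi> y \<in> U \<inter> W" if "y \<in> \<phi> ` (U \<inter> W)" for y
    using that ch(3) by auto
  then have KW: "K \<subseteq> U \<inter> W" using r(2) unfolding K_def by blast
  have off: "\<eta> q = 0" if "q \<notin> K" for q
  proof (rule ccontr)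
    assume "\<eta> q \<noteq> 0"
    then have q: "q \<in> U" "dist (\<phi> p) (\<phi> q) < r" using \<beta>(3) by (auto simp: \<eta>_def split: if_splits)
    then have "inv_into U \<phi> (\<phi> q) \<in> K" unfolding K_def by (intro imageI) simp
    with q that ch(3) show False by simp
  qed
  have "smooth_on (\<phi> ` U) \<beta>" using \<beta>(1) by (auto simp: smooth_on_def intro: Ck_on_subset)
  then have "smooth_fun_on A U (\<lambda>q. \<beta> (\<phi> q))" by (rule smooth_fun_on_chart[OF assms(1) c(1)])
  then have "smooth_fun_on A U (\<lambda>q. complex_of_real (\<beta> (\<phi> q)))"
    by (rule smooth_fun_on_bounded_linear[OF assms(1) ch(1) bounded_linear_of_real])
  then have "smooth_fun_on A U \<eta>"
    by (rule smooth_fun_on_cong[OF assms(1) ch(1), rotated]) (simp add: \<eta>_def)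
  then have "smooth_fun A \<eta>"
    using smooth_fun_zero_extension[OF assms(1) ch(1) K] KW off by blast
  then show thesis
    by (rule that[OF _ _ K]) (use KW off \<beta> c in \<open>auto simp: \<eta>_def\<close>)
qed

section \<open>Tangent vectors and vector fields\<close>

lemma ctangentD:
  assumes "v \<in> ctangent A p"
  shows ctangent_add: "smooth_fun A f \<Longrightarrow> smooth_fun A g \<Longrightarrow> v (\<lambda>x. f x + g x) = v f + v g"
    and ctangent_Leibniz: "smooth_fun A f \<Longrightarrow> smooth_fun A g \<Longrightarrow> v (\<lambda>x. f x * g x) = f p * v g + g p * v f"
    and ctangent_cmult: "smooth_fun A f \<Longrightarrow> v (\<lambda>x. c * f x) = c * v f"
    and ctangent_nonsmooth: "\<not> smooth_fun A f \<Longrightarrow> v f = 0"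
  using assms by (auto simp: ctangent_def)

lemma ctangent_diff:
  assumes "smooth_atlas A" "v \<in> ctangent A p" "smooth_fun A f" "smooth_fun A g"
  shows "v (\<lambda>x. f x - g x) = v f - v g"
  using ctangent_add[OF assms(2,3), of "\<lambda>x. -1 * g x"] ctangent_cmult[OF assms(2,4), of "-1"]
    smooth_fun_on_cmult[OF assms(1) open_UNIV assms(4), of "-1"]
  by simp

lemma ctangent_const:
  assumes "v \<in> ctangent A p"
  shows "v (\<lambda>x. c) = 0"
  using ctangent_Leibniz[OF assms smooth_fun_on_const[where c = 1] smooth_fun_on_const[where c = 1]]
    ctangent_cmult[OF assms smooth_fun_on_const[where c = 1], of c] by simp

lemma ctangent_sum:
  assumes "smooth_atlas A" "v \<in> ctangent A p" "\<And>i. i \<in> I \<Longrightarrow> smooth_fun A (f i)"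
  shows "v (\<lambda>x. \<Sum>i\<in>I. f i x) = (\<Sum>i\<in>I. v (f i))"
  using assms(3)
proof (induction I rule: infinite_finite_induct)
  case (insert i I)
  then have "v (\<lambda>x. f i x + (\<Sum>i\<in>I. f i x)) = v (f i) + v (\<lambda>x. \<Sum>i\<in>I. f i x)"
    by (intro ctangent_add[OF assms(2)] smooth_fun_on_sum[OF assms(1) open_UNIV]) auto
  with insert show ?case by simp
qed (use ctangent_const[OF assms(2)] in auto)

lemma ctangent_vzero: "vzero \<in> ctangent A p"
  by (simp add: ctangent_def vzero_def)

lemma ctangent_vadd:
  assumes "v \<in> ctangent A p" "w \<in> ctangent A p"
  shows "vadd v w \<in> ctangent A p"
  using assms unfolding ctangent_def vadd_def by (simp add: algebra_simps)

lemma ctangent_vscale: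
  assumes "v \<in> ctangent A p"
  shows "vscale c v \<in> ctangent A p"
  using assms unfolding ctangent_def vscale_def by (simp add: algebra_simps)

lemma ctangent_vcnj:
  assumes "smooth_atlas A" "v \<in> ctangent A p"
  shows "vcnj v \<in> ctangent A p"
  using assms(2) unfolding ctangent_def vcnj_def by (simp add: smooth_fun_cnj_iff[OF assms(1)])

lemma vcnj_vcnj [simp]: "vcnj (vcnj v) = v"
  by (simp add: vcnj_def)

lemma vcnj_vadd: "vcnj (vadd v w) = vadd (vcnj v) (vcnj w)"
  by (simp add: vcnj_def vadd_def)

lemma vcnj_vscale: "vcnj (vscale c v) = vscale (cnj c) (vcnj v)"
  by (simp add: vcnj_def vscale_def)

lemma fieldsD:
  assumes "X \<in> fields A"
  shows "X p \<in> ctangent A p" "smooth_fun A f \<Longrightarrow> smooth_fun A (\<lambda>p. X p f)"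
  using assms by (auto simp: fields_def smooth_field_on_def)

lemma fieldsI:
  assumes "\<And>p. X p \<in> ctangent A p" "\<And>f. smooth_fun A f \<Longrightarrow> smooth_fun A (\<lambda>p. X p f)"
  shows "X \<in> fields A"
  using assms by (auto simp: fields_def smooth_field_on_def)

lemma fields_vadd:
  assumes "smooth_atlas A" "X \<in> fields A" "Y \<in> fields A"
  shows "(\<lambda>p. vadd (X p) (Y p)) \<in> fields A"
proof (rule fieldsI)
  show "vadd (X p) (Y p) \<in> ctangent A p" for p
    by (rule ctangent_vadd[OF fieldsD(1)[OF assms(2)] fieldsD(1)[OF assms(3)]])
  show "smooth_fun A (\<lambda>p. vadd (X p) (Y p) f)" if "smooth_fun A f" for f
    unfolding vadd_def
    by (rule smooth_fun_on_add[OF assms(1) open_UNIV fieldsD(2)[OF assms(2) that] fieldsD(2)[OF assms(3) that]])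
qed

lemma fields_vscale:
  assumes "smooth_atlas A" "smooth_fun A \<eta>" "X \<in> fields A"
  shows "(\<lambda>p. vscale (\<eta> p) (X p)) \<in> fields A"
proof (rule fieldsI)
  show "vscale (\<eta> p) (X p) \<in> ctangent A p" for p
    by (rule ctangent_vscale[OF fieldsD(1)[OF assms(3)]])
  show "smooth_fun A (\<lambda>p. vscale (\<eta> p) (X p) f)" if "smooth_fun A f" for f
    unfolding vscale_def
    by (rule smooth_fun_on_mult[OF assms(1) open_UNIV assms(2) fieldsD(2)[OF assms(3) that]])
qed

lemma fields_vcnj:
  assumes "smooth_atlas A" "X \<in> fields A"
  shows "(\<lambda>p. vcnj (X p)) \<in> fields A"
proof (rule fieldsI)
  show "vcnj (X p) \<in> ctangent A p" for p
    by (rule ctangent_vcnj[OF assms(1) fieldsD(1)[OF assms(2)]])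
  show "smooth_fun A (\<lambda>p. vcnj (X p) f)" if "smooth_fun A f" for f
    unfolding vcnj_def
    by (intro smooth_fun_on_cnj[OF assms(1) open_UNIV] fieldsD(2)[OF assms(2)] that)
qed

lemma fields_bracket:
  fixes A :: "('m::topological_space, 'k::finite) chart set"
  assumes "smooth_atlas A" "X \<in> fields A" "Y \<in> fields A"
  shows "bracket X Y \<in> fields A"
proof (rule fieldsI)
  note X = fieldsD[OF assms(2)] and Y = fieldsD[OF assms(3)]
  fix p
  show "bracket X Y p \<in> ctangent A p"
    unfolding ctangent_def
  proof (intro CollectI conjI allI impI)
    fix f g :: "'m \<Rightarrow> complex" and c
    {
      assume f: "smooth_fun A f" and g: "smooth_fun A g"
      note Xf = X(2)[OF f] and Xg = X(2)[OF g] and Yf = Y(2)[OF f] and Yg = Y(2)[OF g]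
      note m = smooth_fun_on_mult[OF assms(1) open_UNIV]
      show "bracket X Y p (\<lambda>x. f x + g x) = bracket X Y p f + bracket X Y p g"
        by (simp add: bracket_def ctangent_add[OF X(1) f g] ctangent_add[OF Y(1) f g]
            ctangent_add[OF X(1) Yf Yg] ctangent_add[OF Y(1) Xf Xg])
      show "bracket X Y p (\<lambda>x. f x * g x) = f p * bracket X Y p g + g p * bracket X Y p f"
        by (simp add: bracket_def ctangent_Leibniz[OF X(1) f g] ctangent_Leibniz[OF Y(1) f g]
            ctangent_add[OF X(1) m[OF f Yg] m[OF g Yf]] ctangent_add[OF Y(1) m[OF f Xg] m[OF g Xf]]
            ctangent_Leibniz[OF X(1) f Yg] ctangent_Leibniz[OF X(1) g Yf]
            ctangent_Leibniz[OF Y(1) f Xg] ctangent_Leibniz[OF Y(1) g Xf] algebra_simps)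
    }
    {
      assume f: "smooth_fun A f"
      show "bracket X Y p (\<lambda>x. c * f x) = c * bracket X Y p f"
        by (simp add: bracket_def ctangent_cmult[OF X(1) f] ctangent_cmult[OF Y(1) f]
            ctangent_cmult[OF X(1) Y(2)[OF f]] ctangent_cmult[OF Y(1) X(2)[OF f]] algebra_simps)
    }
    {
      assume f: "\<not> smooth_fun A f"
      show "bracket X Y p f = 0"
        by (simp add: bracket_def ctangent_nonsmooth[OF X(1) f] ctangent_nonsmooth[OF Y(1) f]
            ctangent_const[OF X(1)] ctangent_const[OF Y(1)])
    }
  qed
next
  fix f :: "'m \<Rightarrow> complex" assume "smooth_fun A f"
  then show "smooth_fun A (\<lambda>p. bracket X Y p f)"
    unfolding bracket_def
    by (intro smooth_fun_on_diff[OF assms(1) open_UNIV] fieldsD(2)[OF assms(2)] fieldsD(2)[OF assms(3)])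
qed

text \<open>Outside \<open>W\<close> the values of \<open>Z\<close> are arbitrary and need not be tangent vectors, but there the factor \<open>\<eta>\<close> is \<open>0\<close>.\<close>

lemma smooth_field_on_cutoff:
  assumes "smooth_atlas A" "open W" "closed K" "K \<subseteq> W" "smooth_fun A \<eta>" "\<And>p. p \<notin> K \<Longrightarrow> \<eta> p = 0"
    and "smooth_field_on A W Z"
  shows "(\<lambda>p. vscale (\<eta> p) (Z p)) \<in> fields A"
proof (rule fieldsI)
  show "vscale (\<eta> p) (Z p) \<in> ctangent A p" for p
  proof (cases "p \<in> W")
    case True
    with assms(7) show ?thesis by (auto simp: smooth_field_on_def intro: ctangent_vscale)
  next
    case False
    with assms(4,6) have "\<eta> p = 0" by blast
    then show ?thesis using ctangent_vzero[of A p] by (simp add: vscale_def vzero_def)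
  qed
  show "smooth_fun A (\<lambda>p. vscale (\<eta> p) (Z p) f)" if "smooth_fun A f" for f
    unfolding vscale_def
    by (rule smooth_fun_zero_extension[OF assms(1-4)])
      (use assms that in \<open>auto simp: smooth_field_on_def
        intro!: smooth_fun_on_mult[OF assms(1,2)] intro: smooth_fun_on_subset\<close>)
qed

lemma smooth_fun_has_derivative:
  assumes "smooth_atlas A" "(U, \<phi>) \<in> A" "smooth_fun A f" "p \<in> U"
  shows "(f \<circ> inv_into U \<phi> has_derivative frechet_derivative (f \<circ> inv_into U \<phi>) (at (\<phi> p))) (at (\<phi> p))"
  using smooth_fun_onD[OF assms(3,2), of 1] assms(4)
  by (auto simp: o_def frechet_derivative_works[symmetric])

text \<open>The derivation property at \<open>p\<close> is the product rule for the Frechet derivative in the chart.\<close>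

lemma coord_vec_in_ctangent:
  fixes A :: "('m::topological_space, 'k::finite) chart set"
  assumes "smooth_atlas A" "(U, \<phi>) \<in> A" "p \<in> U"
  shows "coord_vec A (U, \<phi>) p i \<in> ctangent A p"
proof -
  have inv: "inv_into U \<phi> (\<phi> p) = p" using smooth_atlas_chart(3)[OF assms(1,2)] assms(3) by simp
  note d = smooth_fun_has_derivative[OF assms(1,2) _ assms(3)]
  show ?thesis
    unfolding ctangent_def
  proof (intro CollectI conjI allI impI)
    fix f g :: "'m \<Rightarrow> complex" and c
    {
      assume f: "smooth_fun A f" and g: "smooth_fun A g"
      have "smooth_fun A (\<lambda>x. f x + g x)" "smooth_fun A (\<lambda>x. f x * g x)"
        by (rule smooth_fun_on_add[OF assms(1) open_UNIV f g] smooth_fun_on_mult[OF assms(1) open_UNIV f g])+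
      then show "coord_vec A (U, \<phi>) p i (\<lambda>x. f x + g x) = coord_vec A (U, \<phi>) p i f + coord_vec A (U, \<phi>) p i g"
        and "coord_vec A (U, \<phi>) p i (\<lambda>x. f x * g x) = f p * coord_vec A (U, \<phi>) p i g + g p * coord_vec A (U, \<phi>) p i f"
        using f g frechet_derivative_at[OF has_derivative_add[OF d[OF f] d[OF g]]]
          frechet_derivative_at[OF has_derivative_mult[OF d[OF f] d[OF g]]]
        by (auto simp: coord_vec_def o_def inv fun_eq_iff algebra_simps dest!: spec[of _ "axis i 1"])
    }
    {
      assume f: "smooth_fun A f"
      then have "smooth_fun A (\<lambda>x. c * f x)" by (rule smooth_fun_on_cmult[OF assms(1) open_UNIV])
      then show "coord_vec A (U, \<phi>) p i (\<lambda>x. c * f x) = c * coord_vec A (U, \<phi>) p i f"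
        using f frechet_derivative_at[OF has_derivative_mult_right[OF d[OF f], of c]]
        by (auto simp: coord_vec_def o_def fun_eq_iff dest!: spec[of _ "axis i 1"])
    }
    show "coord_vec A (U, \<phi>) p i f = 0" if "\<not> smooth_fun A f"
      using that by (simp add: coord_vec_def)
  qed
qed

lemma coord_vec_smooth_field:
  fixes A :: "('m::topological_space, 'k::finite) chart set"
  assumes "smooth_atlas A" "(U, \<phi>) \<in> A"
  shows "smooth_field_on A U (\<lambda>p. coord_vec A (U, \<phi>) p i)"
  unfolding smooth_field_on_def
proof (intro conjI ballI allI impI coord_vec_in_ctangent[OF assms])
  fix f :: "'m \<Rightarrow> complex" assume f: "smooth_fun A f"
  let ?G = "\<lambda>y. frechet_derivative (\<lambda>y. f (inv_into U \<phi> y)) (at y) (axis i 1)"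
  have "Ck_on k (\<phi> ` U) ?G" for k
    using Ck_on_SucD(2)[OF smooth_fun_onD[OF f assms(2)], of "axis i 1" k] by simp
  then have "smooth_fun_on A U (\<lambda>p. ?G (\<phi> p))"
    by (intro smooth_fun_on_chart[OF assms]) (simp add: smooth_on_def)
  then show "smooth_fun_on A U (\<lambda>p. coord_vec A (U, \<phi>) p i f)"
    using f by (simp add: coord_vec_def o_def)
qed

lemma ctangent_lincomb:
  assumes "\<And>i. i \<in> I \<Longrightarrow> w i \<in> ctangent A p"
  shows "(\<lambda>f. \<Sum>i\<in>I. c i * w i f) \<in> ctangent A p"
  using assms
proof (induction I rule: infinite_finite_induct)
  case (insert i I)
  then have "vadd (vscale (c i) (w i)) (\<lambda>f. \<Sum>i\<in>I. c i * w i f) \<in> ctangent A p"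
    by (intro ctangent_vadd ctangent_vscale) auto
  with insert show ?case by (simp add: vadd_def vscale_def)
qed (use ctangent_vzero[of A p] in \<open>simp_all add: vzero_def\<close>)

text \<open>A coordinate function is not defined on all of \<open>M\<close>, so it is multiplied by a cut-off \<open>\<eta>\<close>; the second summand is the
  price. It is removed again by comparing with \<open>coord_vec A (U, \<phi>) p j \<eta>\<close>.\<close>

lemma coord_vec_coordinate_product:
  fixes A :: "('m::topological_space, 'k::finite) chart set"
  assumes "smooth_atlas A" "(U, \<phi>) \<in> A" "p \<in> U" "smooth_fun A \<eta>"
    and "smooth_fun A (\<lambda>q. \<eta> q * complex_of_real (\<phi> q $ i))"
  shows "coord_vec A (U, \<phi>) p j (\<lambda>q. \<eta> q * complex_of_real (\<phi> q $ i)) =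
    (if i = j then \<eta> p else 0) + complex_of_real (\<phi> p $ i) * coord_vec A (U, \<phi>) p j \<eta>"
proof -
  note ch = smooth_atlas_chart[OF assms(1,2)]
  have inv: "inv_into U \<phi> (\<phi> p) = p" using ch(3) assms(3) by simp
  let ?D = "frechet_derivative (\<eta> \<circ> inv_into U \<phi>) (at (\<phi> p))"
  have "((\<lambda>y. (\<eta> \<circ> inv_into U \<phi>) y * complex_of_real (y $ i)) has_derivative
      (\<lambda>h. (\<eta> \<circ> inv_into U \<phi>) (\<phi> p) * complex_of_real (h $ i) + ?D h * complex_of_real (\<phi> p $ i))) (at (\<phi> p))"
    by (intro has_derivative_mult smooth_fun_has_derivative[OF assms(1,2,4,3)]
        bounded_linear.has_derivative[OF bounded_linear_of_real]
        bounded_linear.has_derivative[OF bounded_linear_vec_nth] has_derivative_ident)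
  then have "((\<lambda>q. \<eta> q * complex_of_real (\<phi> q $ i)) \<circ> inv_into U \<phi> has_derivative
      (\<lambda>h. \<eta> p * complex_of_real (h $ i) + ?D h * complex_of_real (\<phi> p $ i))) (at (\<phi> p))"
    unfolding inv o_def
    by (rule has_derivative_transform_within_open[OF _ ch(2)])
      (use assms(3) in \<open>auto simp: f_inv_into_f\<close>)
  from fun_cong[OF frechet_derivative_at[OF this], of "axis j 1"] assms(4,5) show ?thesis
    by (simp add: coord_vec_def axis_def mult.commute) (auto simp: mult.commute dest: sym)
qed

lemma smooth_fun_coordinate_product:
  fixes A :: "('m::topological_space, 'k::finite) chart set"
  assumes "smooth_atlas A" "(U, \<phi>) \<in> A" "smooth_fun A \<eta>" "closed K" "K \<subseteq> U" "\<And>q. q \<notin> K \<Longrightarrow> \<eta> q = 0"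
  shows "smooth_fun A (\<lambda>q. \<eta> q * complex_of_real (\<phi> q $ i))"
proof (rule smooth_fun_zero_extension[OF assms(1) _ assms(4,5)])
  note ch = smooth_atlas_chart[OF assms(1,2)]
  show "open U" by (rule ch(1))
  have "Ck_on k (\<phi> ` U) (\<lambda>y. y)" for k
    by (cases k) (auto simp: frechet_derivative_ident Ck_on_const)
  then have "smooth_on (\<phi> ` U) (\<lambda>y. complex_of_real (y $ i))"
    unfolding smooth_on_def
    by (intro allI Ck_on_bounded_linear[OF ch(2) bounded_linear_of_real]
        Ck_on_bounded_linear[OF ch(2) bounded_linear_vec_nth])
  from smooth_fun_on_chart[OF assms(1,2) this]
  show "smooth_fun_on A U (\<lambda>q. \<eta> q * complex_of_real (\<phi> q $ i))"
    using smooth_fun_on_mult[OF assms(1) ch(1) smooth_fun_on_subset[OF assms(3)]] by simp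
qed (use assms(6) in auto)

text \<open>Globally smooth functions dual at \<open>p\<close> to the coordinate vectors: with a bump \<open>\<eta>\<close> at \<open>p\<close>, take
  \<open>\<eta> * (x\<^sub>i - x\<^sub>i(p))\<close>.\<close>

lemma coordinate_functions:
  fixes A :: "('m::t2_space, 'k::finite) chart set"
  assumes "smooth_atlas A" "(U, \<phi>) \<in> A" "p \<in> U"
  obtains y where "\<And>i. smooth_fun A (y i)"
    "\<And>i j. coord_vec A (U, \<phi>) p j (y i) = (if i = j then 1 else 0)"
proof -
  note ch = smooth_atlas_chart[OF assms(1,2)]
  obtain \<eta> :: "'m \<Rightarrow> complex" and K
    where \<eta>: "smooth_fun A \<eta>" "\<eta> p = 1" and K: "closed K" "K \<subseteq> U" "\<And>q. q \<notin> K \<Longrightarrow> \<eta> q = 0"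
    using manifold_bump[OF assms(1) ch(1) assms(3)] by metis
  have s: "smooth_fun A (\<lambda>q. \<eta> q * complex_of_real (\<phi> q $ i))" for i
    by (rule smooth_fun_coordinate_product[OF assms(1,2) \<eta>(1) K])
  have s': "smooth_fun A (\<lambda>q. complex_of_real (\<phi> p $ i) * \<eta> q)" for i
    by (rule smooth_fun_on_cmult[OF assms(1) open_UNIV \<eta>(1)])
  show thesis
  proof (rule that)
    fix i j
    show "smooth_fun A (\<lambda>q. \<eta> q * complex_of_real (\<phi> q $ i) - complex_of_real (\<phi> p $ i) * \<eta> q)"
      by (rule smooth_fun_on_diff[OF assms(1) open_UNIV s s'])
    show "coord_vec A (U, \<phi>) p j (\<lambda>q. \<eta> q * complex_of_real (\<phi> q $ i) - complex_of_real (\<phi> p $ i) * \<eta> q) =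
        (if i = j then 1 else 0)"
      by (simp add: ctangent_diff[OF assms(1) coord_vec_in_ctangent[OF assms] s s']
          ctangent_cmult[OF coord_vec_in_ctangent[OF assms] \<eta>(1)]
          coord_vec_coordinate_product[OF assms \<eta>(1) s] \<eta>(2))
  qed
qed

section \<open>Coordinate vectors span the tangent space\<close>

text \<open>A dimension count in place of a Taylor expansion. If \<open>CARD('k)\<close> vectors \<open>w\<close> span the tangent space and
  \<open>y\<close> are the functions dual to the coordinate vectors \<open>D\<close>, expanding the coordinate vectors in \<open>w\<close> gives a matrix
  which is a left inverse of the square matrix \<open>w j (y l)\<close>, hence also a right inverse. So a vector annihilating all \<open>y l\<close>
  has zero coefficients, and subtracting \<open>\<Sum>i. v (y i) * D i\<close> from \<open>v\<close> leaves such a vector.\<close>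

lemma ctangent_coord_expansion:
  fixes A :: "('m::t2_space, 'k::finite) chart set" and w :: "'k \<Rightarrow> 'm cvector"
  assumes "smooth_atlas A" "(U, \<phi>) \<in> A" "p \<in> U"
    and span: "\<And>v. v \<in> ctangent A p \<Longrightarrow> \<exists>c. v = (\<lambda>f. \<Sum>j\<in>UNIV. c j * w j f)"
    and v: "v \<in> ctangent A p"
  obtains a where "v = (\<lambda>f. \<Sum>i\<in>UNIV. a i * coord_vec A (U, \<phi>) p i f)"
proof -
  obtain y where y: "\<And>i. smooth_fun A (y i)"
    "\<And>i j. coord_vec A (U, \<phi>) p j (y i) = (if i = j then 1 else 0)"
    by (rule coordinate_functions[OF assms(1-3)]) blast
  let ?D = "coord_vec A (U, \<phi>) p"
  note D = coord_vec_in_ctangent[OF assms(1-3)]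
  have "\<forall>i. \<exists>c. ?D i = (\<lambda>f. \<Sum>j\<in>UNIV. c j * w j f)" using span[OF D] by blast
  then obtain M where M: "\<And>i. ?D i = (\<lambda>f. \<Sum>j\<in>UNIV. M i j * w j f)" by metis
  define MM :: "complex ^ 'k ^ 'k" where "MM = (\<chi> i j. M i j)"
  define N :: "complex ^ 'k ^ 'k" where "N = (\<chi> j l. w j (y l))"
  have "(MM ** N) $ i $ l = mat 1 $ i $ l" for i l
  proof -
    have "(\<Sum>j\<in>UNIV. M i j * w j (y l)) = (if l = i then 1 else 0)"
      using fun_cong[OF M[of i], of "y l"] y(2)[of i l] by (rule trans[OF sym])
    then show ?thesis by (simp add: MM_def N_def matrix_matrix_mult_def mat_def eq_commute)
  qed
  then have "MM ** N = mat 1" by (simp add: vec_eq_iff)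
  then have NM: "N ** MM = mat 1" by (simp add: matrix_left_right_inverse)
  define u where "u = vadd v (vscale (- 1) (\<lambda>f. \<Sum>i\<in>UNIV. v (y i) * ?D i f))"
  have "u \<in> ctangent A p"
    unfolding u_def by (intro ctangent_vadd ctangent_vscale v ctangent_lincomb D)
  then obtain c where c: "u = (\<lambda>f. \<Sum>j\<in>UNIV. c j * w j f)" using span by blast
  have uy: "u (y l) = 0" for l
  proof -
    have "(\<Sum>i\<in>UNIV. v (y i) * (if l = i then 1 else 0)) = (\<Sum>i\<in>UNIV. if l = i then v (y i) else 0)"
      by (rule sum.cong) auto
    then show ?thesis by (simp add: u_def vadd_def vscale_def y(2))
  qed
  have "c k = 0" for k
  proof -
    have "c k = (\<Sum>j\<in>UNIV. c j * (N ** MM) $ j $ k)"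
    proof -
      have "c j * (N ** MM) $ j $ k = (if j = k then c k else 0)" for j by (simp add: NM mat_def)
      then show ?thesis by simp
    qed
    also have "\<dots> = (\<Sum>j\<in>UNIV. \<Sum>l\<in>UNIV. c j * N $ j $ l * MM $ l $ k)"
      by (simp add: matrix_matrix_mult_def sum_distrib_left mult.assoc)
    also have "\<dots> = (\<Sum>l\<in>UNIV. (\<Sum>j\<in>UNIV. c j * N $ j $ l) * MM $ l $ k)"
      by (subst sum.swap) (simp add: sum_distrib_right)
    also have "\<dots> = 0" using uy by (simp add: c N_def)
    finally show ?thesis .
  qed
  then have u0: "u f = 0" for f by (simp add: c)
  have "v f = (\<Sum>i\<in>UNIV. v (y i) * ?D i f)" for f
    using u0[of f] by (simp add: u_def vadd_def vscale_def)
  then show thesis by (intro that[of "\<lambda>i. v (y i)"] ext)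
qed

locale pseudoconvex_CR_manifold =
  fixes A :: "('m::t2_space, 'k::finite) chart set" and n :: nat
    and E10 :: "'m \<Rightarrow> 'm cvector set" and \<theta> :: "'m \<Rightarrow> 'm cvector \<Rightarrow> complex"
  assumes pseudoconvex: "strongly_pseudoconvex_CR A n E10 \<theta>"
begin

lemma atlas: "smooth_atlas A"
  and card_dim: "CARD('k) = 2 * n + 1"
  and E10_subbundle: "subbundle A n E10"
  and E10_Int_conj: "E10 p \<inter> conj_bundle E10 p = {vzero}"
  and E10_integrable: "formally_integrable A E10"
  and contact: "contact_form A n \<theta>"
  and one_form: "real_one_form A \<theta>"
  and levi_eq: "levi_distribution E10 p = {v \<in> rtangent A p. \<theta> p v = 0}"
  using pseudoconvex
  by (auto simp: strongly_pseudoconvex_CR_def cr_structure_def contact_form_def)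

lemma theta_vadd: "v \<in> ctangent A p \<Longrightarrow> w \<in> ctangent A p \<Longrightarrow> \<theta> p (vadd v w) = \<theta> p v + \<theta> p w"
  and theta_vscale: "v \<in> ctangent A p \<Longrightarrow> \<theta> p (vscale c v) = c * \<theta> p v"
  and theta_vcnj: "v \<in> ctangent A p \<Longrightarrow> \<theta> p (vcnj v) = cnj (\<theta> p v)"
  and theta_smooth: "X \<in> fields A \<Longrightarrow> smooth_fun A (\<lambda>p. \<theta> p (X p))"
  using one_form unfolding real_one_form_def by blast+

lemma theta_lincomb:
  assumes "\<And>i. i \<in> I \<Longrightarrow> w i \<in> ctangent A p"
  shows "\<theta> p (\<lambda>f. \<Sum>i\<in>I. c i * w i f) = (\<Sum>i\<in>I. c i * \<theta> p (w i))"
  using assms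
proof (induction I rule: infinite_finite_induct)
  case (insert i I)
  have w: "w i \<in> ctangent A p" "(\<lambda>f. \<Sum>i\<in>I. c i * w i f) \<in> ctangent A p"
    using insert.prems by (auto intro: ctangent_lincomb)
  have "\<theta> p (vadd (vscale (c i) (w i)) (\<lambda>f. \<Sum>i\<in>I. c i * w i f)) =
      c i * \<theta> p (w i) + \<theta> p (\<lambda>f. \<Sum>i\<in>I. c i * w i f)"
    using theta_vadd[OF ctangent_vscale[OF w(1)] w(2)] theta_vscale[OF w(1)] by simp
  with insert show ?case by (simp add: vadd_def vscale_def)
qed (use theta_vscale[OF ctangent_vzero, of p 0] in \<open>simp_all add: vzero_def vscale_def\<close>)

lemma E10_frame:
  obtains W Z where "open W" "p \<in> W" "\<And>j. j < n \<Longrightarrow> smooth_field_on A W (Z j)"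
    "\<And>q. q \<in> W \<Longrightarrow> E10 q = {(\<lambda>f. \<Sum>j<n. c j * Z j q f) | c. True}"
proof -
  from E10_subbundle[unfolded subbundle_def, rule_format, of p]
  obtain W Z where "open W" "p \<in> W" "\<forall>j<n. smooth_field_on A W (Z j)"
    and "\<forall>q\<in>W. E10 q = {(\<lambda>f. \<Sum>j<n. c j * Z j q f) | c. True} \<and>
      (\<forall>c. (\<lambda>f. \<Sum>j<n. c j * Z j q f) = vzero \<longrightarrow> (\<forall>j<n. c j = 0))"
    by (elim exE conjE)
  then show thesis by (intro that[of W Z]) auto
qed

lemma E10_ctangent:
  assumes "v \<in> E10 p"
  shows "v \<in> ctangent A p"
proof -
  obtain W Z where Z: "open W" "p \<in> W" "\<And>j. j < n \<Longrightarrow> smooth_field_on A W (Z j)"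
    "\<And>q. q \<in> W \<Longrightarrow> E10 q = {(\<lambda>f. \<Sum>j<n. c j * Z j q f) | c. True}"
    by (rule E10_frame[of p]) blast
  with assms obtain c where "v = (\<lambda>f. \<Sum>j<n. c j * Z j p f)" by auto
  moreover have "Z j p \<in> ctangent A p" if "j < n" for j
    using Z(2) Z(3)[OF that] by (auto simp: smooth_field_on_def)
  ultimately show ?thesis by (auto intro: ctangent_lincomb)
qed

lemma E10_vadd:
  assumes "v \<in> E10 p" "w \<in> E10 p"
  shows "vadd v w \<in> E10 p"
proof -
  obtain W Z where "open W" "p \<in> W" and
    Z: "\<And>q. q \<in> W \<Longrightarrow> E10 q = {(\<lambda>f. \<Sum>j<n. c j * Z j q f) | c. True}"
    by (rule E10_frame[of p]) blast
  from assms obtain c d where "v = (\<lambda>f. \<Sum>j<n. c j * Z j p f)" "w = (\<lambda>f. \<Sum>j<n. d j * Z j p f)"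
    unfolding Z[OF \<open>p \<in> W\<close>] by blast
  then have "vadd v w = (\<lambda>f. \<Sum>j<n. (c j + d j) * Z j p f)"
    by (simp add: vadd_def sum.distrib algebra_simps)
  then show ?thesis unfolding Z[OF \<open>p \<in> W\<close>]
    by (intro CollectI exI[of _ "\<lambda>j. c j + d j"] conjI TrueI)
qed

lemma E10_vscale:
  assumes "v \<in> E10 p"
  shows "vscale b v \<in> E10 p"
proof -
  obtain W Z where "open W" "p \<in> W" and
    Z: "\<And>q. q \<in> W \<Longrightarrow> E10 q = {(\<lambda>f. \<Sum>j<n. c j * Z j q f) | c. True}"
    by (rule E10_frame[of p]) blast
  from assms obtain c where "v = (\<lambda>f. \<Sum>j<n. c j * Z j p f)"
    unfolding Z[OF \<open>p \<in> W\<close>] by blast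
  then have "vscale b v = (\<lambda>f. \<Sum>j<n. (b * c j) * Z j p f)"
    by (simp add: vscale_def sum_distrib_left algebra_simps)
  then show ?thesis unfolding Z[OF \<open>p \<in> W\<close>]
    by (intro CollectI exI[of _ "\<lambda>j. b * c j"] conjI TrueI)
qed

lemma vzero_E10: "vzero \<in> E10 p"
  using E10_Int_conj by blast

text \<open>For \<open>v\<close> in \<open>E10\<close> the real vector \<open>v + vcnj v\<close> lies in the kernel of \<open>\<theta>\<close>, so \<open>Re (\<theta> v) = 0\<close>. Applying this to \<open>\<i> v\<close>
  as well kills the imaginary part.\<close>

lemma theta_E10:
  assumes "v \<in> E10 p"
  shows "\<theta> p v = 0"
proof -
  have re: "\<theta> p w + cnj (\<theta> p w) = 0" if "w \<in> E10 p" for w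
  proof -
    have "vadd w (vcnj w) \<in> levi_distribution E10 p"
      using that by (auto simp: levi_distribution_def)
    then have "\<theta> p (vadd w (vcnj w)) = 0" by (simp add: levi_eq)
    then show ?thesis
      using theta_vadd theta_vcnj E10_ctangent[OF that] ctangent_vcnj[OF atlas] by simp
  qed
  from re[OF assms] re[OF E10_vscale[OF assms, of \<i>]] theta_vscale[OF E10_ctangent[OF assms], of \<i>]
  show ?thesis by (simp add: complex_eq_iff)
qed

text \<open>Cut off a constant combination of a local frame. Sections of \<open>E10\<close> therefore see every vector of \<open>E10\<close>, which is
  what turns equations between sections into pointwise ones.\<close>

lemma E10_extends_to_section:
  assumes "v \<in> E10 p"
  obtains X where "X \<in> sections_of A E10" "X p = v"
proof -
  obtain W Z where W: "open W" "p \<in> W" and Zs: "\<And>j. j < n \<Longrightarrow> smooth_field_on A W (Z j)" and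
    Z: "\<And>q. q \<in> W \<Longrightarrow> E10 q = {(\<lambda>f. \<Sum>j<n. c j * Z j q f) | c. True}"
    by (rule E10_frame[of p]) blast
  obtain \<eta> :: "'m \<Rightarrow> complex" and K
    where \<eta>: "smooth_fun A \<eta>" "\<eta> p = 1" and K: "closed K" "K \<subseteq> W" "\<And>q. q \<notin> K \<Longrightarrow> \<eta> q = 0"
    using manifold_bump[OF atlas W] by metis
  from assms obtain c where v: "v = (\<lambda>f. \<Sum>j<n. c j * Z j p f)"
    unfolding Z[OF W(2)] by blast
  define Y where "Y q = (\<lambda>f. \<Sum>j<n. c j * Z j q f)" for q
  have Ys: "smooth_field_on A W Y"
    unfolding smooth_field_on_def Y_def
    using Zs by (auto simp: smooth_field_on_def intro!: ctangent_lincomb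
        smooth_fun_on_sum[OF atlas W(1)] smooth_fun_on_cmult[OF atlas W(1)])
  have F: "(\<lambda>q. vscale (\<eta> q) (Y q)) \<in> fields A"
    by (rule smooth_field_on_cutoff[OF atlas W(1) K(1,2) \<eta>(1) K(3) Ys])
  have "vscale (\<eta> q) (Y q) \<in> E10 q" for q
  proof (cases "q \<in> W")
    case True
    then have "Y q \<in> E10 q" unfolding Z[OF True] Y_def by blast
    then show ?thesis by (rule E10_vscale)
  next
    case False
    with K have "\<eta> q = 0" by blast
    then show ?thesis using vzero_E10[of q] by (simp add: vscale_def vzero_def)
  qed
  with F have "(\<lambda>q. vscale (\<eta> q) (Y q)) \<in> sections_of A E10" by (simp add: sections_of_def)
  then show thesis by (rule that) (simp add: \<eta>(2) Y_def v vscale_def)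
qed

text \<open>The volume form is a sum of products containing a value of \<open>\<theta>\<close> each.\<close>

lemma theta_nonzero:
  obtains T where "T \<in> rtangent A p" "\<theta> p T \<noteq> 0"
proof -
  from contact obtain v where v: "\<And>j. v j \<in> rtangent A p" "contact_volume_form A n \<theta> p v \<noteq> 0"
    unfolding contact_form_def by meson
  have "\<exists>j. \<theta> p (v j) \<noteq> 0"
  proof (rule ccontr)
    assume "\<nexists>j. \<theta> p (v j) \<noteq> 0"
    then have "contact_volume_form A n \<theta> p v = 0" by (simp add: contact_volume_form_def)
    with v(2) show False by contradiction
  qed
  with v(1) that show thesis by blast
qed

text \<open>Subtracting a multiple of \<open>T\<close> leaves a real vector in the kernel of \<open>\<theta>\<close>, that is, in the Levi distribution.\<close>

lemma rtangent_decomposition: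
  assumes T: "T \<in> rtangent A p" "\<theta> p T \<noteq> 0" and u: "u \<in> rtangent A p"
  obtains a c where "a \<in> E10 p" "u = vadd (vadd a (vcnj a)) (vscale c T)"
proof -
  have Tc: "T \<in> ctangent A p" "vcnj T = T" and uc: "u \<in> ctangent A p" "vcnj u = u"
    using T u by (auto simp: rtangent_def)
  define c where "c = \<theta> p u / \<theta> p T"
  have c: "cnj c = c" using theta_vcnj[OF Tc(1)] theta_vcnj[OF uc(1)] Tc uc by (simp add: c_def)
  define u' where "u' = vadd u (vscale (- c) T)"
  have "u' \<in> ctangent A p" "vcnj u' = u'"
    unfolding u'_def using Tc uc c by (auto intro!: ctangent_vadd ctangent_vscale simp: vcnj_vadd vcnj_vscale)
  moreover have "\<theta> p u' = 0"
    using T(2) by (simp add: u'_def theta_vadd[OF uc(1) ctangent_vscale[OF Tc(1)]] theta_vscale[OF Tc(1)] c_def)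
  ultimately have "u' \<in> levi_distribution E10 p" by (simp add: levi_eq rtangent_def)
  then obtain a where "a \<in> E10 p" "u' = vadd a (vcnj a)" by (auto simp: levi_distribution_def)
  moreover from this have "u = vadd (vadd a (vcnj a)) (vscale c T)"
    by (auto simp: u'_def vadd_def vscale_def fun_eq_iff algebra_simps)
  ultimately show thesis using that by blast
qed

lemma ctangent_decomposition:
  assumes T: "T \<in> rtangent A p" "\<theta> p T \<noteq> 0" and v: "v \<in> ctangent A p"
  obtains a b c where "a \<in> E10 p" "b \<in> E10 p" "v = vadd (vadd a (vcnj b)) (vscale c T)"
proof -
  define x where "x = vscale (1/2) (vadd v (vcnj v))"
  define y where "y = vscale (- \<i> / 2) (vadd v (vscale (-1) (vcnj v)))"
  have "vcnj x = x" "vcnj y = y"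
    unfolding x_def y_def vcnj_vscale vcnj_vadd vcnj_vcnj
    by (simp_all add: vadd_def vscale_def algebra_simps)
  moreover have "x \<in> ctangent A p" "y \<in> ctangent A p"
    unfolding x_def y_def by (intro ctangent_vadd ctangent_vscale ctangent_vcnj[OF atlas] v)+
  ultimately have "x \<in> rtangent A p" "y \<in> rtangent A p" by (simp_all add: rtangent_def)
  then obtain a c b d where ab: "a \<in> E10 p" "x = vadd (vadd a (vcnj a)) (vscale c T)"
    "b \<in> E10 p" "y = vadd (vadd b (vcnj b)) (vscale d T)"
    by (metis rtangent_decomposition[OF T])
  have "v = vadd x (vscale \<i> y)"
    by (simp add: x_def y_def vadd_def vscale_def fun_eq_iff algebra_simps)
  also have "\<dots> = vadd (vadd (vadd a (vscale \<i> b)) (vcnj (vadd a (vscale (- \<i>) b)))) (vscale (c + \<i> * d) T)"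
    unfolding ab vcnj_vadd vcnj_vscale by (simp add: vadd_def vscale_def fun_eq_iff algebra_simps)
  finally show thesis by (rule that[rotated 2]) (intro E10_vadd E10_vscale ab)+
qed

text \<open>The tangent space is \<open>E10 \<oplus> conj E10\<close> plus a line transverse to the kernel of \<open>\<theta>\<close>, so a frame of \<open>E10\<close>, its conjugate
  and \<open>T\<close> span it: \<open>2 * n + 1 = CARD('k)\<close> vectors, the number needed for the dimension count.\<close>

lemma ctangent_spanned:
  obtains w :: "'k \<Rightarrow> 'm cvector"
  where "\<And>v. v \<in> ctangent A p \<Longrightarrow> \<exists>c. v = (\<lambda>f. \<Sum>j\<in>UNIV. c j * w j f)"
proof -
  obtain T where T: "T \<in> rtangent A p" "\<theta> p T \<noteq> 0" by (rule theta_nonzero)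
  obtain W Z where W: "open W" "p \<in> W" and
    Z: "\<And>q. q \<in> W \<Longrightarrow> E10 q = {(\<lambda>f. \<Sum>j<n. c j * Z j q f) | c. True}"
    by (rule E10_frame[of p]) blast
  let ?I = "{..<n} <+> ({..<n} <+> {()})"
  have "card ?I = CARD('k)" by (simp add: card_Plus card_dim)
  then obtain e :: "'k \<Rightarrow> _" where e: "bij_betw e UNIV ?I"
    using finite_same_card_bij[of "UNIV :: 'k set" ?I] by auto
  define w where "w = case_sum (\<lambda>j. Z j p) (case_sum (\<lambda>j. vcnj (Z j p)) (\<lambda>_::unit. T))"
  show thesis
  proof (rule that)
    fix v assume "v \<in> ctangent A p"
    then obtain a b c where ab: "a \<in> E10 p" "b \<in> E10 p" and v: "v = vadd (vadd a (vcnj b)) (vscale c T)"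
      by (rule ctangent_decomposition[OF T])
    from ab obtain \<alpha> \<beta> where ab': "a = (\<lambda>f. \<Sum>j<n. \<alpha> j * Z j p f)" "b = (\<lambda>f. \<Sum>j<n. \<beta> j * Z j p f)"
      unfolding Z[OF W(2)] by blast
    define d where "d = case_sum \<alpha> (case_sum (\<lambda>j. cnj (\<beta> j)) (\<lambda>_::unit. c))"
    have "v f = (\<Sum>j\<in>UNIV. d (e j) * w (e j) f)" for f
    proof -
      have "v f = (\<Sum>x\<in>?I. d x * w x f)"
        by (simp add: v ab' vadd_def vscale_def vcnj_def sum.Plus o_def d_def w_def)
      also have "\<dots> = (\<Sum>j\<in>UNIV. d (e j) * w (e j) f)"
        by (rule sum.reindex_bij_betw[OF e, symmetric])
      finally show ?thesis .
    qed
    then show "\<exists>c. v = (\<lambda>f. \<Sum>j\<in>UNIV. c j * w (e j) f)"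
      by (intro exI[of _ "\<lambda>j. d (e j)"] ext)
  qed
qed

lemma coord_expansion:
  assumes "(U, \<phi>) \<in> A" "p \<in> U" "v \<in> ctangent A p"
  obtains a where "v = (\<lambda>f. \<Sum>i\<in>UNIV. a i * coord_vec A (U, \<phi>) p i f)"
proof -
  obtain w :: "'k \<Rightarrow> 'm cvector"
    where w: "\<And>v. v \<in> ctangent A p \<Longrightarrow> \<exists>c. v = (\<lambda>f. \<Sum>j\<in>UNIV. c j * w j f)"
    by (rule ctangent_spanned) blast
  show thesis by (rule ctangent_coord_expansion[OF atlas assms(1,2) w assms(3)]) (auto intro: that)
qed

section \<open>Cartan's formula is tensorial\<close>

text \<open>Near \<open>p\<close> one has \<open>X = \<Sum>i. a\<^sub>i D\<^sub>i\<close> in the coordinate vectors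
  \<open>D\<^sub>i\<close>, with \<open>a\<^sub>i(p) = 0\<close>. To get a global statement, let \<open>\<eta>\<close> be a bump at \<open>p\<close> and write
  \<open>X = (1 - \<eta>\<^sup>3) X + \<Sum>i. (\<eta>\<^sup>2 a\<^sub>i) (\<eta> D\<^sub>i)\<close>. Here \<open>\<eta>\<^sup>2 a\<^sub>i = \<eta> X(\<eta> x\<^sub>i) - \<eta> x\<^sub>i X(\<eta>)\<close> is visibly smooth on all of \<open>M\<close>. The
  index \<open>None\<close> stands for the first summand.\<close>

lemma vanishing_field_expansion:
  assumes X: "X \<in> fields A" and Xp: "X p = vzero"
  obtains b :: "'k option \<Rightarrow> 'm \<Rightarrow> complex" and W
  where "\<And>i. smooth_fun A (b i)" "\<And>i. b i p = 0" "\<And>i. W i \<in> fields A"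
    "\<And>q. X q = (\<lambda>f. \<Sum>i\<in>UNIV. b i q * W i q f)"
proof -
  obtain U \<phi> where c: "(U, \<phi>) \<in> A" "p \<in> U" by (rule smooth_atlas_covers[OF atlas])
  note ch = smooth_atlas_chart[OF atlas c(1)]
  obtain \<eta> :: "'m \<Rightarrow> complex" and K
    where \<eta>: "smooth_fun A \<eta>" "\<eta> p = 1" and K: "closed K" "K \<subseteq> U" "\<And>q. q \<notin> K \<Longrightarrow> \<eta> q = 0"
    using manifold_bump[OF atlas ch(1) c(2)] by metis
  let ?x = "\<lambda>i q. complex_of_real (\<phi> q $ i)"
  have s: "smooth_fun A (\<lambda>q. \<eta> q * ?x i q)" for i
    by (rule smooth_fun_coordinate_product[OF atlas c(1) \<eta>(1) K])
  define a where "a i q = \<eta> q * X q (\<lambda>q. \<eta> q * ?x i q) - (\<eta> q * ?x i q) * X q \<eta>" for i q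
  define b where "b = case_option (\<lambda>q. 1 - \<eta> q * (\<eta> q * \<eta> q)) a"
  define W where "W = case_option X (\<lambda>i q. vscale (\<eta> q) (coord_vec A (U, \<phi>) q i))"
  note m = smooth_fun_on_mult[OF atlas open_UNIV] and d = smooth_fun_on_diff[OF atlas open_UNIV]
  have a_s: "smooth_fun A (a i)" for i
    unfolding a_def by (rule d[OF m[OF \<eta>(1) fieldsD(2)[OF X s]] m[OF s fieldsD(2)[OF X \<eta>(1)]]])
  have bs: "smooth_fun A (b i)" for i
  proof (cases i)
    case None
    have "smooth_fun A (\<lambda>q. 1 - \<eta> q * (\<eta> q * \<eta> q))"
      by (rule d[OF smooth_fun_on_const m[OF \<eta>(1) m[OF \<eta>(1) \<eta>(1)]]])
    then show ?thesis by (simp add: None b_def)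
  qed (simp add: b_def a_s)
  have bp: "b i p = 0" for i
    by (cases i) (auto simp: b_def a_def \<eta>(2) Xp vzero_def)
  have Ws: "W i \<in> fields A" for i
  proof (cases i)
    case (Some j)
    have "(\<lambda>q. vscale (\<eta> q) (coord_vec A (U, \<phi>) q j)) \<in> fields A"
      by (rule smooth_field_on_cutoff[OF atlas ch(1) K(1,2) \<eta>(1) K(3) coord_vec_smooth_field[OF atlas c(1)]])
    then show ?thesis by (simp add: Some W_def)
  qed (simp add: W_def X)
  have eq: "X q f = (\<Sum>i\<in>UNIV. b i q * W i q f)" for q f
  proof -
    have "\<eta> q * (\<eta> q * \<eta> q) * X q f = (\<Sum>i\<in>UNIV. a i q * (\<eta> q * coord_vec A (U, \<phi>) q i f))"
    proof (cases "q \<in> U")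
      case True
      obtain \<alpha> where \<alpha>: "X q = (\<lambda>f. \<Sum>i\<in>UNIV. \<alpha> i * coord_vec A (U, \<phi>) q i f)"
        by (rule coord_expansion[OF c(1) True fieldsD(1)[OF X]]) blast
      have "a i q = \<eta> q * \<eta> q * \<alpha> i" for i
      proof -
        have "X q (\<lambda>q. \<eta> q * ?x i q) =
            (\<Sum>j\<in>UNIV. \<alpha> j * ((if i = j then \<eta> q else 0) + ?x i q * coord_vec A (U, \<phi>) q j \<eta>))"
          unfolding \<alpha> using coord_vec_coordinate_product[OF atlas c(1) True \<eta>(1) s] by simp
        also have "\<dots> = \<alpha> i * \<eta> q + ?x i q * X q \<eta>"
        proof -
          have "(\<Sum>j\<in>UNIV. \<alpha> j * (if i = j then \<eta> q else 0)) = (\<Sum>j\<in>UNIV. if i = j then \<alpha> j * \<eta> q else 0)"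
            by (rule sum.cong) auto
          moreover have "?x i q * X q \<eta> = (\<Sum>j\<in>UNIV. \<alpha> j * (?x i q * coord_vec A (U, \<phi>) q j \<eta>))"
            unfolding \<alpha> by (simp add: sum_distrib_left mult.left_commute)
          ultimately show ?thesis by (simp only: distrib_left sum.distrib) simp
        qed
        finally show ?thesis by (simp add: a_def algebra_simps)
      qed
      then show ?thesis unfolding \<alpha> by (simp add: sum_distrib_left algebra_simps)
    next
      case False
      with K have "\<eta> q = 0" by blast
      then show ?thesis by simp
    qed
    then show ?thesis
      by (simp add: UNIV_option_conv sum.reindex b_def W_def vscale_def algebra_simps)
  qed
  show thesis by (rule that[where b = b and W = W, OF bs bp Ws]) (use eq in blast)
qed

text \<open>Write \<open>X = \<Sum>i. b i * W i\<close> with \<open>b i p = 0\<close>. Then by the Leibniz rule both sides equal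
  \<open>\<Sum>i. Y p (b i) * \<theta> p (W i p)\<close>: the derivatives of \<open>W i\<close> and of \<open>\<theta>\<close> come with the factor \<open>b i p\<close>.\<close>

lemma theta_derivative_of_vanishing_field:
  assumes X: "X \<in> fields A" and Xp: "X p = vzero" and Y: "Y \<in> fields A"
  shows "\<theta> p (\<lambda>f. Y p (\<lambda>q. X q f)) = Y p (\<lambda>q. \<theta> q (X q))"
proof -
  obtain b :: "'k option \<Rightarrow> 'm \<Rightarrow> complex" and W
    where b: "\<And>i. smooth_fun A (b i)" "\<And>i. b i p = 0" and W: "\<And>i. W i \<in> fields A"
      and eq: "\<And>q. X q = (\<lambda>f. \<Sum>i\<in>UNIV. b i q * W i q f)"
    by (rule vanishing_field_expansion[OF X Xp]) blast
  note Yp = fieldsD(1)[OF Y, of p]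
  note m = smooth_fun_on_mult[OF atlas open_UNIV]
  have "Y p (\<lambda>q. X q f) = (\<Sum>i\<in>UNIV. Y p (b i) * W i p f)" for f
  proof (cases "smooth_fun A f")
    case True
    show ?thesis
      unfolding eq
      using ctangent_sum[OF atlas Yp, of UNIV "\<lambda>i q. b i q * W i q f"] m[OF b(1) fieldsD(2)[OF W True]]
      by (simp add: ctangent_Leibniz[OF Yp b(1) fieldsD(2)[OF W True]] b(2) mult.commute)
  next
    case False
    then show ?thesis
      by (simp add: ctangent_nonsmooth[OF fieldsD(1)[OF X]] ctangent_nonsmooth[OF fieldsD(1)[OF W]]
          ctangent_const[OF Yp])
  qed
  then have "\<theta> p (\<lambda>f. Y p (\<lambda>q. X q f)) = (\<Sum>i\<in>UNIV. Y p (b i) * \<theta> p (W i p))"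
    using theta_lincomb[OF fieldsD(1)[OF W]] by simp
  also have "\<dots> = Y p (\<lambda>q. \<Sum>i\<in>UNIV. b i q * \<theta> q (W i q))"
    using ctangent_sum[OF atlas Yp, of UNIV "\<lambda>i q. b i q * \<theta> q (W i q)"] m[OF b(1) theta_smooth[OF W]]
    by (simp add: ctangent_Leibniz[OF Yp b(1) theta_smooth[OF W]] b(2) mult.commute)
  also have "\<dots> = Y p (\<lambda>q. \<theta> q (X q))"
  proof -
    have "\<theta> q (\<lambda>f. \<Sum>i\<in>UNIV. b i q * W i q f) = (\<Sum>i\<in>UNIV. b i q * \<theta> q (W i q))" for q
      by (rule theta_lincomb) (rule fieldsD(1)[OF W])
    then show ?thesis by (simp add: eq)
  qed
  finally show ?thesis .
qed

text \<open>The expression that characterises \<open>ext_d\<close>, as a function of two fields.\<close>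

definition cartan :: "'m cfield \<Rightarrow> 'm cfield \<Rightarrow> 'm \<Rightarrow> complex" where
  "cartan X Y p = X p (\<lambda>q. \<theta> q (Y q)) - Y p (\<lambda>q. \<theta> q (X q)) - \<theta> p (bracket X Y p)"

lemma cartan_swap:
  assumes "X \<in> fields A" "Y \<in> fields A"
  shows "cartan Y X p = - cartan X Y p"
proof -
  have "bracket Y X p = vscale (-1) (bracket X Y p)" by (simp add: bracket_def vscale_def)
  then show ?thesis
    using theta_vscale[OF fieldsD(1)[OF fields_bracket[OF atlas assms]], where c = "-1"] by (simp add: cartan_def)
qed

text \<open>For \<open>V = X - X'\<close> the difference of the two sides is
  \<open>- Y p (\<theta> V) + \<theta> p (\<lambda>f. Y p (V f))\<close>, which is \<open>0\<close> because \<open>V\<close> vanishes at \<open>p\<close>.\<close>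

lemma cartan_cong_left:
  assumes X: "X \<in> fields A" and X': "X' \<in> fields A" and Y: "Y \<in> fields A" and eq: "X p = X' p"
  shows "cartan X Y p = cartan X' Y p"
proof -
  define V where "V = (\<lambda>q. vadd (X q) (vscale (-1) (X' q)))"
  note nX' = fields_vscale[OF atlas smooth_fun_on_const[where c = "-1"] X']
  have V: "V \<in> fields A" unfolding V_def by (rule fields_vadd[OF atlas X nX'])
  have Vp: "V p = vzero" by (simp add: V_def eq vadd_def vscale_def vzero_def)
  note Yp = fieldsD(1)[OF Y, of p]
  have tV: "\<theta> q (V q) = \<theta> q (X q) - \<theta> q (X' q)" for q
    using theta_vadd[OF fieldsD(1)[OF X] fieldsD(1)[OF nX']] theta_vscale[OF fieldsD(1)[OF X'], where c = "-1"]
    by (simp add: V_def)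
  have 1: "Y p (\<lambda>q. \<theta> q (V q)) = Y p (\<lambda>q. \<theta> q (X q)) - Y p (\<lambda>q. \<theta> q (X' q))"
    unfolding tV by (rule ctangent_diff[OF atlas Yp theta_smooth[OF X] theta_smooth[OF X']])
  define D where "D = (\<lambda>f. Y p (\<lambda>q. V q f))"
  have DB: "D = vscale (-1) (bracket V Y p)" by (simp add: D_def bracket_def Vp vscale_def vzero_def)
  have D: "D \<in> ctangent A p"
    unfolding DB by (rule ctangent_vscale[OF fieldsD(1)[OF fields_bracket[OF atlas V Y]]])
  have YV: "Y p (\<lambda>q. V q f) = Y p (\<lambda>q. X q f) - Y p (\<lambda>q. X' q f)" for f
  proof (cases "smooth_fun A f")
    case True
    have "V q f = X q f - X' q f" for q by (simp add: V_def vadd_def vscale_def)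
    then show ?thesis
      using ctangent_diff[OF atlas Yp fieldsD(2)[OF X True] fieldsD(2)[OF X' True]] by simp
  next
    case False
    then show ?thesis
      by (simp add: ctangent_nonsmooth[OF fieldsD(1)[OF X]] ctangent_nonsmooth[OF fieldsD(1)[OF X']]
          ctangent_nonsmooth[OF fieldsD(1)[OF V]] ctangent_const[OF Yp])
  qed
  have "bracket X' Y p = vadd (bracket X Y p) D"
    by (simp add: bracket_def vadd_def eq D_def YV)
  then have "\<theta> p (bracket X' Y p) = \<theta> p (bracket X Y p) + \<theta> p D"
    using theta_vadd[OF fieldsD(1)[OF fields_bracket[OF atlas X Y]] D] by simp
  moreover have "\<theta> p D = Y p (\<lambda>q. \<theta> q (V q))"
    unfolding D_def by (rule theta_derivative_of_vanishing_field[OF V Vp Y])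
  ultimately show ?thesis using 1 by (simp add: cartan_def eq)
qed

text \<open>By tensoriality in each argument, the value does not depend on the extensions of \<open>X p\<close> and \<open>Y p\<close>, so the definite
  description in \<open>ext_d\<close> is satisfied by exactly one number.\<close>

lemma ext_d_eq_cartan:
  assumes X: "X \<in> fields A" and Y: "Y \<in> fields A"
  shows "ext_d A \<theta> p (X p) (Y p) = cartan X Y p"
proof -
  have *: "cartan X' Y' p = cartan X Y p"
    if X': "X' \<in> fields A" and Y': "Y' \<in> fields A" and eq: "X' p = X p" "Y' p = Y p" for X' Y'
  proof -
    have "cartan X' Y' p = cartan X Y' p" by (rule cartan_cong_left[OF X' X Y' eq(1)])
    also have "\<dots> = - cartan Y' X p" using cartan_swap[OF Y' X] by simp
    also have "\<dots> = - cartan Y X p" using cartan_cong_left[OF Y' Y X eq(2)] by simp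
    also have "\<dots> = cartan X Y p" using cartan_swap[OF X Y] by simp
    finally show ?thesis .
  qed
  show ?thesis
    unfolding ext_d_def
  proof (rule the_equality, intro ballI impI)
    fix X' Y' assume "X' \<in> fields A" "Y' \<in> fields A" "X' p = X p" "Y' p = Y p"
    from *[OF this]
    show "cartan X Y p = X' p (\<lambda>q. \<theta> q (Y' q)) - Y' p (\<lambda>q. \<theta> q (X' q)) - \<theta> p (bracket X' Y' p)"
      unfolding cartan_def by (rule sym)
  next
    fix c assume "\<forall>X'\<in>fields A. \<forall>Y'\<in>fields A. X' p = X p \<longrightarrow> Y' p = Y p \<longrightarrow>
      c = X' p (\<lambda>q. \<theta> q (Y' q)) - Y' p (\<lambda>q. \<theta> q (X' q)) - \<theta> p (bracket X' Y' p)"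
    from this[rule_format, OF X Y refl refl] show "c = cartan X Y p"
      unfolding cartan_def .
  qed
qed

lemma ext_d_smooth:
  assumes X: "X \<in> fields A" and Y: "Y \<in> fields A"
  shows "smooth_fun A (\<lambda>p. ext_d A \<theta> p (X p) (Y p))"
proof -
  have "smooth_fun A (\<lambda>p. cartan X Y p)"
    unfolding cartan_def
    by (rule smooth_fun_on_diff[OF atlas open_UNIV smooth_fun_on_diff[OF atlas open_UNIV
          fieldsD(2)[OF X theta_smooth[OF Y]] fieldsD(2)[OF Y theta_smooth[OF X]]]
          theta_smooth[OF fields_bracket[OF atlas X Y]]])
  then show ?thesis by (simp add: ext_d_eq_cartan[OF X Y])
qed

lemma ext_d_vscale:
  assumes X: "X \<in> fields A" and Y: "Y \<in> fields A"
  shows "ext_d A \<theta> p (vscale c (X p)) (vscale d (Y p)) = c * d * ext_d A \<theta> p (X p) (Y p)"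
proof -
  note cX = fields_vscale[OF atlas smooth_fun_on_const[where c = c] X]
    and dY = fields_vscale[OF atlas smooth_fun_on_const[where c = d] Y]
  note Xp = fieldsD(1)[OF X] and Yp = fieldsD(1)[OF Y]
  have "bracket (\<lambda>q. vscale c (X q)) (\<lambda>q. vscale d (Y q)) p f = c * d * bracket X Y p f" for f
  proof (cases "smooth_fun A f")
    case True
    then show ?thesis
      by (simp add: bracket_def vscale_def ctangent_cmult[OF Xp fieldsD(2)[OF Y]]
          ctangent_cmult[OF Yp fieldsD(2)[OF X]] algebra_simps)
  next
    case False
    then show ?thesis
      by (simp add: ctangent_nonsmooth[OF fieldsD(1)[OF fields_bracket[OF atlas X Y]]]
          ctangent_nonsmooth[OF fieldsD(1)[OF fields_bracket[OF atlas cX dY]]])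
  qed
  then have "bracket (\<lambda>q. vscale c (X q)) (\<lambda>q. vscale d (Y q)) p = vscale (c * d) (bracket X Y p)"
    by (simp add: vscale_def fun_eq_iff)
  then have "cartan (\<lambda>q. vscale c (X q)) (\<lambda>q. vscale d (Y q)) p = c * d * cartan X Y p"
    using theta_vscale[OF Xp] theta_vscale[OF Yp]
      ctangent_cmult[OF Xp theta_smooth[OF Y]] ctangent_cmult[OF Yp theta_smooth[OF X]]
      theta_vscale[OF fieldsD(1)[OF fields_bracket[OF atlas X Y]], where c = "c * d"]
    by (simp add: cartan_def vscale_def algebra_simps)
  then show ?thesis
    using ext_d_eq_cartan[OF cX dY, of p] ext_d_eq_cartan[OF X Y, of p] by simp
qed

section \<open>The CR polarization and the quantum bundle\<close>

lemma sections_E10_fields: "X \<in> sections_of A E10 \<Longrightarrow> X \<in> fields A"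
  by (simp add: sections_of_def)

text \<open>Extend \<open>v\<close> and \<open>w\<close> to sections of \<open>E10\<close>. Since \<open>\<theta>\<close> vanishes on \<open>E10\<close> and the bracket is again a section of \<open>E10\<close>, all
  three terms of Cartan's formula vanish.\<close>

lemma ext_d_E10:
  assumes "v \<in> E10 p" "w \<in> E10 p"
  shows "ext_d A \<theta> p v w = 0"
proof -
  obtain X where X: "X \<in> sections_of A E10" "X p = v" by (rule E10_extends_to_section[OF assms(1)])
  obtain Y where Y: "Y \<in> sections_of A E10" "Y p = w" by (rule E10_extends_to_section[OF assms(2)])
  note XF = sections_E10_fields[OF X(1)] and YF = sections_E10_fields[OF Y(1)]
  have "bracket X Y \<in> sections_of A E10"
    using E10_integrable X(1) Y(1) by (simp add: formally_integrable_def)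
  then have "\<theta> p (bracket X Y p) = 0" by (simp add: sections_of_def theta_E10)
  moreover have "\<theta> q (X q) = 0" "\<theta> q (Y q) = 0" for q
    using X Y by (simp_all add: sections_of_def theta_E10)
  ultimately have "cartan X Y p = 0"
    by (simp add: cartan_def ctangent_const[OF fieldsD(1)[OF XF]] ctangent_const[OF fieldsD(1)[OF YF]])
  then show ?thesis using ext_d_eq_cartan[OF XF YF, of p] X(2) Y(2) by simp
qed

lemma E10_plus_conj:
  "{vadd v w | v w. v \<in> E10 p \<and> w \<in> conj_bundle E10 p} = complexification (levi_distribution E10) p"
proof (intro equalityI subsetI)
  fix u assume "u \<in> {vadd v w | v w. v \<in> E10 p \<and> w \<in> conj_bundle E10 p}"
  then obtain v w where vw: "v \<in> E10 p" "w \<in> E10 p" "u = vadd v (vcnj w)"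
    by (auto simp: conj_bundle_def)
  define a where "a = vscale (1/2) (vadd v w)"
  define b where "b = vscale (- \<i> / 2) (vadd v (vscale (-1) w))"
  have "a \<in> E10 p" "b \<in> E10 p" unfolding a_def b_def by (intro E10_vadd E10_vscale vw)+
  moreover have "u = vadd (vadd a (vcnj a)) (vscale \<i> (vadd b (vcnj b)))"
    unfolding a_def b_def vw(3) vcnj_vscale vcnj_vadd
    by (simp add: vadd_def vscale_def fun_eq_iff field_simps)
  ultimately show "u \<in> complexification (levi_distribution E10) p"
    unfolding complexification_def levi_distribution_def by blast
next
  fix u assume "u \<in> complexification (levi_distribution E10) p"
  then obtain a b where ab: "a \<in> E10 p" "b \<in> E10 p"
    and u: "u = vadd (vadd a (vcnj a)) (vscale \<i> (vadd b (vcnj b)))"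
    by (auto simp: complexification_def levi_distribution_def)
  have "u = vadd (vadd a (vscale \<i> b)) (vcnj (vadd a (vscale (- \<i>) b)))"
    unfolding u vcnj_vscale vcnj_vadd
    by (simp add: vadd_def vscale_def fun_eq_iff algebra_simps)
  moreover have "vadd a (vscale \<i> b) \<in> E10 p" "vadd a (vscale (- \<i>) b) \<in> E10 p"
    by (intro E10_vadd E10_vscale ab)+
  ultimately show "u \<in> {vadd v w | v w. v \<in> E10 p \<and> w \<in> conj_bundle E10 p}"
    unfolding conj_bundle_def by blast
qed

lemma E10_cr_polarization:
  "cr_polarization A (levi_distribution E10) (\<lambda>p v w. - ext_d A \<theta> p v w) E10"
  unfolding cr_polarization_def
  using E10_subbundle E10_integrable E10_Int_conj E10_plus_conj ext_d_E10 by auto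

lemma triv_conn_smooth:
  assumes "X \<in> fields A" "smooth_fun A (\<lambda>x. snd (s x))"
  shows "smooth_fun A (\<lambda>x. X x (\<lambda>y. snd (s y)) - \<i> * \<theta> x (X x) * snd (s x))"
  by (rule smooth_fun_on_diff[OF atlas open_UNIV fieldsD(2)[OF assms]
      smooth_fun_on_mult[OF atlas open_UNIV smooth_fun_on_cmult[OF atlas open_UNIV theta_smooth[OF assms(1)]] assms(2)]])

lemma triv_conn_connection: "connection A (triv_conn \<theta>)"
  unfolding connection_def
proof (intro ballI conjI allI impI)
  fix X and s :: "'m lsection" assume X: "X \<in> fields A" and "s \<in> smooth_lsections A"
  then have s: "smooth_fun A (\<lambda>x. snd (s x))" by (simp add: smooth_lsections_def)
  note Xp = fieldsD(1)[OF X]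
  show "triv_conn \<theta> X s \<in> smooth_lsections A"
    using triv_conn_smooth[OF X s] by (simp add: smooth_lsections_def lsections_def triv_conn_def)
  show "triv_conn \<theta> (\<lambda>p. vadd (X p) (Y p)) s = ladd (triv_conn \<theta> X s) (triv_conn \<theta> Y s)"
    if "Y \<in> fields A" for Y
    by (simp add: triv_conn_def ladd_def theta_vadd[OF Xp fieldsD(1)[OF that]] fun_eq_iff)
      (simp add: vadd_def algebra_simps)
  show "triv_conn \<theta> X (ladd s t) = ladd (triv_conn \<theta> X s) (triv_conn \<theta> X t)"
    if "t \<in> smooth_lsections A" for t
    using that by (simp add: triv_conn_def ladd_def smooth_lsections_def ctangent_add[OF Xp s] algebra_simps)
  fix f :: "'m \<Rightarrow> complex" assume f: "smooth_fun A f"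
  show "triv_conn \<theta> (\<lambda>p. vscale (f p) (X p)) s = lscale f (triv_conn \<theta> X s)"
    by (simp add: triv_conn_def lscale_def theta_vscale[OF Xp] fun_eq_iff)
      (simp add: vscale_def algebra_simps)
  show "triv_conn \<theta> X (lscale f s) = ladd (lscale (\<lambda>p. X p f) s) (lscale f (triv_conn \<theta> X s))"
    by (simp add: triv_conn_def lscale_def ladd_def ctangent_Leibniz[OF Xp f s] algebra_simps)
qed

lemma triv_h_hermitian: "hermitian_metric A triv_h"
proof -
  have "Re (z * cnj z) > 0" if "z \<noteq> 0" for z
    using that by (simp add: complex_mult_cnj sum_power2_gt_zero_iff complex_eq_iff)
  moreover have "smooth_fun A (\<lambda>x. snd (s x) * cnj (snd (t x)))"
    if "s \<in> smooth_lsections A" "t \<in> smooth_lsections A" for s t :: "'m lsection"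
    using that by (auto simp: smooth_lsections_def
        intro: smooth_fun_on_mult[OF atlas open_UNIV _ smooth_fun_on_cnj[OF atlas open_UNIV]])
  ultimately show ?thesis
    by (auto simp: hermitian_metric_def triv_h_def algebra_simps)
qed

lemma triv_conn_metric: "metric_connection A triv_h (triv_conn \<theta>)"
  unfolding metric_connection_def
proof (intro conjI triv_conn_connection ballI allI)
  fix X and s t :: "'m lsection" and p
  assume "X \<in> real_fields A" "s \<in> smooth_lsections A" "t \<in> smooth_lsections A"
  then have X: "X \<in> fields A" and re: "vcnj (X p) = X p"
    and s: "smooth_fun A (\<lambda>x. snd (s x))" and t: "smooth_fun A (\<lambda>x. snd (t x))"
    by (auto simp: real_fields_def rtangent_def smooth_lsections_def)
  note Xp = fieldsD(1)[OF X]
  have tc: "smooth_fun A (\<lambda>x. cnj (snd (t x)))" by (rule smooth_fun_on_cnj[OF atlas open_UNIV t])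
  have c: "X p (\<lambda>x. cnj (snd (t x))) = cnj (X p (\<lambda>x. snd (t x)))"
    using fun_cong[OF re, of "\<lambda>x. cnj (snd (t x))"] by (simp add: vcnj_def)
  have "cnj (\<theta> p (X p)) = \<theta> p (X p)" using theta_vcnj[OF Xp, of p] re by simp
  then show "X p (\<lambda>x. triv_h x (s x) (t x)) =
      triv_h p (triv_conn \<theta> X s p) (t p) + triv_h p (s p) (triv_conn \<theta> X t p)"
    by (simp add: triv_h_def triv_conn_def ctangent_Leibniz[OF Xp s tc] c algebra_simps)
qed

text \<open>In the commutator of \<open>X - \<i> \<theta>(X)\<close> and \<open>Y - \<i> \<theta>(Y)\<close> the products \<open>\<theta>(X) \<theta>(Y)\<close> cancel; what remains beyond the bracket is
  \<open>- \<i>\<close> times Cartan's formula.\<close>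

lemma triv_conn_curvature:
  assumes X: "X \<in> fields A" and Y: "Y \<in> fields A" and s: "smooth_fun A (\<lambda>x. snd (s x))"
  shows "curvature (triv_conn \<theta>) X Y s p = (p, - \<i> * ext_d A \<theta> p (X p) (Y p) * snd (s p))"
proof -
  note Xp = fieldsD(1)[OF X, of p] and Yp = fieldsD(1)[OF Y, of p]
  note Xs = fieldsD(2)[OF X s] and Ys = fieldsD(2)[OF Y s]
  note tX = theta_smooth[OF X] and tY = theta_smooth[OF Y]
  note c = smooth_fun_on_cmult[OF atlas open_UNIV] and m = smooth_fun_on_mult[OF atlas open_UNIV]
  have 1: "X p (\<lambda>x. Y x (\<lambda>y. snd (s y)) - \<i> * \<theta> x (Y x) * snd (s x)) = X p (\<lambda>x. Y x (\<lambda>y. snd (s y))) -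
      \<i> * (\<theta> p (Y p) * X p (\<lambda>y. snd (s y)) + snd (s p) * X p (\<lambda>x. \<theta> x (Y x)))"
    by (simp add: ctangent_diff[OF atlas Xp Ys m[OF c[OF tY] s]] ctangent_Leibniz[OF Xp c[OF tY] s]
        ctangent_cmult[OF Xp tY]) (simp add: algebra_simps)
  have 2: "Y p (\<lambda>x. X x (\<lambda>y. snd (s y)) - \<i> * \<theta> x (X x) * snd (s x)) = Y p (\<lambda>x. X x (\<lambda>y. snd (s y))) -
      \<i> * (\<theta> p (X p) * Y p (\<lambda>y. snd (s y)) + snd (s p) * Y p (\<lambda>x. \<theta> x (X x)))"
    by (simp add: ctangent_diff[OF atlas Yp Xs m[OF c[OF tX] s]] ctangent_Leibniz[OF Yp c[OF tX] s]
        ctangent_cmult[OF Yp tX]) (simp add: algebra_simps)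
  have 3: "bracket X Y p (\<lambda>y. snd (s y)) = X p (\<lambda>x. Y x (\<lambda>y. snd (s y))) - Y p (\<lambda>x. X x (\<lambda>y. snd (s y)))"
    by (simp add: bracket_def)
  show ?thesis
    by (simp add: curvature_def triv_conn_def 1 2 3 ext_d_eq_cartan[OF X Y] cartan_def)
      (simp add: algebra_simps)
qed

lemma triv_quantum_bundle:
  "quantum_bundle A (levi_distribution E10) (\<lambda>p v w. - ext_d A \<theta> p v w) triv_h (triv_conn \<theta>)"
  unfolding quantum_bundle_def
  using triv_h_hermitian triv_conn_metric
  by (auto simp: real_fields_def smooth_lsections_def triv_conn_curvature)

text \<open>The connection form \<open>- \<i> \<theta>\<close> vanishes on the conjugate of \<open>E10\<close>. Hence covariant differentiation along the
  conjugate of the polarization is the tangential Cauchy--Riemann operator on arbitrary sections, which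
  covers the smooth and the weak equations at once.\<close>

lemma triv_conn_conj_E10:
  assumes "Z \<in> sections_of A E10"
  shows "triv_conn \<theta> (\<lambda>p. vcnj (Z p)) s = (\<lambda>x. (x, vcnj (Z x) (\<lambda>y. snd (s y))))"
proof -
  have "\<theta> x (vcnj (Z x)) = 0" for x
  proof -
    have "Z x \<in> E10 x" using assms by (simp add: sections_of_def)
    then show ?thesis using theta_vcnj[OF E10_ctangent] theta_E10 by simp
  qed
  then show ?thesis by (simp add: triv_conn_def)
qed

lemma polarized_iff_dbar_L:
  "polarized A E10 (triv_conn \<theta>) s \<longleftrightarrow> dbar_L E10 s = dual_zero"
proof
  assume pol: "polarized A E10 (triv_conn \<theta>) s"
  have "vcnj v (\<lambda>y. snd (s y)) = 0" if v: "v \<in> E10 x" for v x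
  proof -
    obtain Z where Z: "Z \<in> sections_of A E10" "Z x = v" by (rule E10_extends_to_section[OF v])
    with pol have "triv_conn \<theta> (\<lambda>p. vcnj (Z p)) s x = lzero x" by (simp add: polarized_def)
    then show ?thesis by (simp add: triv_conn_conj_E10[OF Z(1)] lzero_def Z(2))
  qed
  then show "dbar_L E10 s = dual_zero"
    by (auto simp: dbar_L_def dual_zero_def dbar_b_def conj_bundle_def fun_eq_iff)
next
  assume dbar: "dbar_L E10 s = dual_zero"
  have "w (\<lambda>y. snd (s y)) = 0" if "w \<in> conj_bundle E10 x" for w x
  proof -
    have "dbar_b E10 (\<lambda>y. snd (s y)) x = (\<lambda>w. 0)"
      using fun_cong[OF dbar, of x] by (simp add: dbar_L_def dual_zero_def)
    from fun_cong[OF this, of w] that show ?thesis by (simp add: dbar_b_def)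
  qed
  then have "vcnj (Z x) (\<lambda>y. snd (s y)) = 0" if "Z \<in> sections_of A E10" for Z x
    using that by (auto simp: sections_of_def conj_bundle_def)
  then show "polarized A E10 (triv_conn \<theta>) s"
    by (simp add: polarized_def lzero_def triv_conn_conj_E10)
qed

lemma sections_conj_bundle:
  "sections_of A (conj_bundle E10) = (\<lambda>Z p. vcnj (Z p)) ` sections_of A E10"
proof (intro equalityI subsetI)
  fix W assume W: "W \<in> sections_of A (conj_bundle E10)"
  have "vcnj (W p) \<in> E10 p" for p
  proof -
    have "W p \<in> vcnj ` E10 p" using W by (simp add: sections_of_def conj_bundle_def)
    then show ?thesis by auto
  qed
  with W have "(\<lambda>p. vcnj (W p)) \<in> sections_of A E10"
    using fields_vcnj[OF atlas, of W] by (simp add: sections_of_def)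
  from imageI[OF this, of "\<lambda>Z p. vcnj (Z p)"]
  show "W \<in> (\<lambda>Z p. vcnj (Z p)) ` sections_of A E10" by simp
next
  fix W assume "W \<in> (\<lambda>Z p. vcnj (Z p)) ` sections_of A E10"
  then obtain Z where "Z \<in> sections_of A E10" "W = (\<lambda>p. vcnj (Z p))" by blast
  then show "W \<in> sections_of A (conj_bundle E10)"
    using fields_vcnj[OF atlas, of Z] by (simp add: sections_of_def conj_bundle_def)
qed

lemma L2_polarized_eq_L2_CR_sections:
  "L2_polarized A \<mu> E10 h (triv_conn \<theta>) = L2_CR_sections A \<mu> E10 h"
proof -
  have "triv_conn \<theta> (\<lambda>p. vcnj (Z p)) = (\<lambda>t x. (x, snd (dbar_L E10 t x) (vcnj (Z x))))"
    if Z: "Z \<in> sections_of A E10" for Z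
  proof -
    have "vcnj (Z x) \<in> conj_bundle E10 x" for x
      using Z by (simp add: sections_of_def conj_bundle_def)
    then show ?thesis by (simp add: fun_eq_iff triv_conn_conj_E10[OF Z] dbar_L_def dbar_b_def)
  qed
  then show ?thesis
    by (simp add: L2_polarized_def L2_CR_sections_def sections_conj_bundle cong: ball_cong)
qed

end

section \<open>Spaces of classes of square integrable functions\<close>

lemma ae_class_cong:
  assumes "AE x in \<mu>. s x = t x"
  shows "ae_class \<mu> V s = ae_class \<mu> V t"
proof -
  have "(AE x in \<mu>. r x = s x) \<longleftrightarrow> (AE x in \<mu>. r x = t x)" for r
  proof
    assume "AE x in \<mu>. r x = s x"
    with assms show "AE x in \<mu>. r x = t x" by eventually_elim simp
  next
    assume "AE x in \<mu>. r x = t x"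
    with assms show "AE x in \<mu>. r x = s x" by eventually_elim simp
  qed
  then show ?thesis by (simp add: ae_class_def)
qed

lemma ae_class_self: "s \<in> V \<Longrightarrow> s \<in> ae_class \<mu> V s"
  by (simp add: ae_class_def)

lemma class_add_ae_class:
  assumes "f \<in> V" "g \<in> V"
  shows "class_add \<mu> V (\<lambda>f g x. f x + g x) (ae_class \<mu> V f) (ae_class \<mu> V g) = ae_class \<mu> V (\<lambda>x. f x + g x)"
proof -
  have "ae_class \<mu> V (\<lambda>x. f' x + g' x) = ae_class \<mu> V (\<lambda>x. f x + g x)"
    if "f' \<in> ae_class \<mu> V f" "g' \<in> ae_class \<mu> V g" for f' g'
  proof (rule ae_class_cong)
    have "AE x in \<mu>. f' x = f x" "AE x in \<mu>. g' x = g x" using that by (simp_all add: ae_class_def)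
    then show "AE x in \<mu>. f' x + g' x = f x + g x" by eventually_elim simp
  qed
  with ae_class_self[OF assms(1)] ae_class_self[OF assms(2)] show ?thesis
    unfolding class_add_def by blast
qed

lemma class_scale_ae_class:
  assumes "f \<in> V"
  shows "class_scale \<mu> V (\<lambda>c f x. c * f x) c (ae_class \<mu> V f) = ae_class \<mu> V (\<lambda>x. c * f x)"
proof -
  have "ae_class \<mu> V (\<lambda>x. c * f' x) = ae_class \<mu> V (\<lambda>x. c * f x)" if "f' \<in> ae_class \<mu> V f" for f'
  proof (rule ae_class_cong)
    have "AE x in \<mu>. f' x = f x" using that by (simp add: ae_class_def)
    then show "AE x in \<mu>. c * f' x = c * f x" by eventually_elim simp
  qed
  with ae_class_self[OF assms] show ?thesis unfolding class_scale_def by blast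
qed

lemma L2_functionsD:
  assumes "f \<in> L2_functions \<mu>"
  shows "f \<in> borel_measurable \<mu>" "integrable \<mu> (\<lambda>x. (cmod (f x))\<^sup>2)"
  using assms by (auto simp: L2_functions_def)

lemma L2_functions_add:
  assumes "f \<in> L2_functions \<mu>" "g \<in> L2_functions \<mu>"
  shows "(\<lambda>x. f x + g x) \<in> L2_functions \<mu>"
proof -
  note f = L2_functionsD[OF assms(1)] and g = L2_functionsD[OF assms(2)]
  have meas: "(\<lambda>x. f x + g x) \<in> borel_measurable \<mu>" using f g by measurable
  have "(cmod (f x + g x))\<^sup>2 \<le> 2 * (cmod (f x))\<^sup>2 + 2 * (cmod (g x))\<^sup>2" for x
  proof -
    have "(cmod (f x + g x))\<^sup>2 \<le> (cmod (f x) + cmod (g x))\<^sup>2"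
      by (intro power_mono norm_triangle_ineq) simp
    also have "\<dots> \<le> 2 * (cmod (f x))\<^sup>2 + 2 * (cmod (g x))\<^sup>2"
      using sum_squares_bound[of "cmod (f x)" "cmod (g x)"] by (simp add: power2_sum)
    finally show ?thesis .
  qed
  then have bound: "AE x in \<mu>. norm ((cmod (f x + g x))\<^sup>2) \<le> norm (2 * (cmod (f x))\<^sup>2 + 2 * (cmod (g x))\<^sup>2)"
    by simp
  have "integrable \<mu> (\<lambda>x. (cmod (f x + g x))\<^sup>2)"
  proof (rule Bochner_Integration.integrable_bound[OF _ _ bound])
    show "integrable \<mu> (\<lambda>x. 2 * (cmod (f x))\<^sup>2 + 2 * (cmod (g x))\<^sup>2)" using f g by simp
    show "(\<lambda>x. (cmod (f x + g x))\<^sup>2) \<in> borel_measurable \<mu>" using meas by measurable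
  qed
  with meas show ?thesis by (simp add: L2_functions_def)
qed

lemma L2_functions_scale:
  assumes "f \<in> L2_functions \<mu>"
  shows "(\<lambda>x. c * f x) \<in> L2_functions \<mu>"
  using L2_functionsD[OF assms] by (simp add: L2_functions_def norm_mult power_mult_distrib)

lemma L2_product_integrable:
  assumes "f \<in> L2_functions \<mu>" "g \<in> L2_functions \<mu>"
  shows "integrable \<mu> (\<lambda>x. f x * cnj (g x))"
proof -
  note f = L2_functionsD[OF assms(1)] and g = L2_functionsD[OF assms(2)]
  have "cmod (f x * cnj (g x)) \<le> (cmod (f x))\<^sup>2 + (cmod (g x))\<^sup>2" for x
  proof -
    have "0 \<le> cmod (f x) * cmod (g x)" by simp
    then show ?thesis
      using sum_squares_bound[of "cmod (f x)" "cmod (g x)"] unfolding norm_mult complex_mod_cnj by linarith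
  qed
  then have bound: "AE x in \<mu>. norm (f x * cnj (g x)) \<le> norm ((cmod (f x))\<^sup>2 + (cmod (g x))\<^sup>2)"
    by simp
  show ?thesis
  proof (rule Bochner_Integration.integrable_bound[OF _ _ bound])
    show "integrable \<mu> (\<lambda>x. (cmod (f x))\<^sup>2 + (cmod (g x))\<^sup>2)" using f g by simp
    show "(\<lambda>x. f x * cnj (g x)) \<in> borel_measurable \<mu>" using f(1)
      by (intro borel_measurable_times measurable_compose[OF g(1) borel_measurable_continuous_onI]
          continuous_on_cnj continuous_on_id)
  qed
qed

text \<open>The integrability of both products is essential: the integral of a non-integrable function is \<open>0\<close> by convention,
  and additivity could fail.\<close>

lemma function_inner_add:
  assumes "f \<in> L2_functions \<mu>" "g \<in> L2_functions \<mu>" "t \<in> L2_functions \<mu>"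
  shows "function_inner \<mu> (\<lambda>x. f x + g x) t = function_inner \<mu> f t + function_inner \<mu> g t"
  using Bochner_Integration.integral_add[OF L2_product_integrable[OF assms(1,3)] L2_product_integrable[OF assms(2,3)]]
  by (simp add: function_inner_def distrib_right)

lemma function_inner_scale: "function_inner \<mu> (\<lambda>x. c * f x) t = c * function_inner \<mu> f t"
  by (simp add: function_inner_def mult.assoc)

lemma function_inner_cong_AE:
  assumes "f \<in> L2_functions \<mu>" "f' \<in> L2_functions \<mu>" "g \<in> L2_functions \<mu>" "g' \<in> L2_functions \<mu>"
    and "AE x in \<mu>. f' x = f x" "AE x in \<mu>. g' x = g x"
  shows "function_inner \<mu> f' g' = function_inner \<mu> f g"
  unfolding function_inner_def
proof (rule integral_cong_AE)
  show "AE x in \<mu>. f' x * cnj (g' x) = f x * cnj (g x)"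
    using assms(5,6) by eventually_elim simp
qed (use L2_product_integrable assms in \<open>auto intro: borel_measurable_integrable\<close>)

lemma class_inner_ae_class:
  assumes "f \<in> L2_functions \<mu>" "g \<in> L2_functions \<mu>"
  shows "class_inner (function_inner \<mu>) (ae_class \<mu> (L2_functions \<mu>) f) (ae_class \<mu> (L2_functions \<mu>) g) =
    function_inner \<mu> f g"
proof -
  let ?F = "ae_class \<mu> (L2_functions \<mu>) f" and ?G = "ae_class \<mu> (L2_functions \<mu>) g"
  have "?F \<noteq> {}" "?G \<noteq> {}" using ae_class_self[OF assms(1)] ae_class_self[OF assms(2)] by blast+
  then have "(SOME s. s \<in> ?F) \<in> ?F" "(SOME s. s \<in> ?G) \<in> ?G" by (simp_all add: some_in_eq)
  then show ?thesis
    unfolding class_inner_def using assms by (intro function_inner_cong_AE) (auto simp: ae_class_def)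
qed

text \<open>The trivialisation. All section spaces are images of function spaces under it, which transports their operations
  and the distributional equations; composing with \<open>snd\<close> inverts it.\<close>

definition lsection_of :: "('m \<Rightarrow> complex) \<Rightarrow> 'm lsection" where
  "lsection_of f = (\<lambda>x. (x, f x))"

lemma snd_lsection_of [simp]: "(\<lambda>x. snd (lsection_of f x)) = f"
  by (simp add: lsection_of_def)

lemma lsections_eq: "lsections = range lsection_of"
proof (intro equalityI subsetI)
  fix s :: "'a lsection" assume "s \<in> lsections"
  then have "s = lsection_of (\<lambda>x. snd (s x))"
    by (auto simp: lsections_def lsection_of_def fun_eq_iff prod_eq_iff)
  then show "s \<in> range lsection_of" by blast
qed (auto simp: lsections_def lsection_of_def)

lemma lsections_Collect: "{s \<in> lsections. Q (\<lambda>x. snd (s x))} = lsection_of ` {f. Q f}"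
  by (auto simp: lsections_eq)

lemma smooth_lsections_eq: "smooth_lsections A = lsection_of ` {f. smooth_fun A f}"
  unfolding smooth_lsections_def by (rule lsections_Collect)

lemma L2_sections_eq: "L2_sections \<mu> triv_h = lsection_of ` L2_functions \<mu>"
proof -
  have "integrable \<mu> (\<lambda>x. f x * cnj (f x)) \<longleftrightarrow> integrable \<mu> (\<lambda>x. (cmod (f x))\<^sup>2)" for f :: "'a \<Rightarrow> complex"
    unfolding complex_norm_square[symmetric] by (rule complex_of_real_integrable_eq)
  then show ?thesis
    unfolding L2_sections_def L2_functions_def triv_h_def
    using lsections_Collect[of "\<lambda>f. f \<in> borel_measurable \<mu> \<and> integrable \<mu> (\<lambda>x. f x * cnj (f x))"] by simp
qed

lemma section_inner_lsection_of:
  "section_inner \<mu> triv_h (lsection_of f) (lsection_of g) = function_inner \<mu> f g"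
  by (simp add: section_inner_def function_inner_def triv_h_def lsection_of_def)

lemma distributional_zero_image:
  assumes "\<And>a b. ip (j a) (j b) = ip' a b" "\<And>s. D (j s) = j (D' s)"
  shows "distributional_zero (j ` T) ip D (j u) \<longleftrightarrow> distributional_zero T ip' D' u"
  by (simp add: distributional_zero_def assms)

lemma L2_CR_sections_eq: "L2_CR_sections A \<mu> E10 triv_h = lsection_of ` L2_CR_functions A \<mu> E10"
proof -
  have "(\<lambda>t x. (x, snd (dbar_L E10 t x) (W x))) (lsection_of g) =
      lsection_of (\<lambda>x. dbar_b E10 g x (W x))" for W and g :: "'a \<Rightarrow> complex"
    by (simp add: dbar_L_def lsection_of_def)
  then have "distributional_zero (smooth_lsections A) (section_inner \<mu> triv_h)
      (\<lambda>t x. (x, snd (dbar_L E10 t x) (W x))) (lsection_of f) \<longleftrightarrow>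
    distributional_zero {g. smooth_fun A g} (function_inner \<mu>) (\<lambda>g x. dbar_b E10 g x (W x)) f" for W f
    unfolding smooth_lsections_eq
    by (intro distributional_zero_image section_inner_lsection_of)
  then show ?thesis
    by (auto simp: L2_CR_sections_def L2_CR_functions_def L2_sections_eq)
qed

lemma ae_class_lsection_of:
  "ae_class \<mu> (lsection_of ` V) (lsection_of f) = lsection_of ` ae_class \<mu> V f"
  by (auto simp: ae_class_def lsection_of_def)

lemma class_add_lsection_of:
  "class_add \<mu> (lsection_of ` V) ladd (lsection_of ` a) (lsection_of ` b) =
   lsection_of ` class_add \<mu> V (\<lambda>f g x. f x + g x) a b"
proof -
  have "ladd (lsection_of f) (lsection_of g) = lsection_of (\<lambda>x. f x + g x)" for f g :: "'a \<Rightarrow> complex"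
    by (simp add: ladd_def lsection_of_def)
  then show ?thesis by (simp add: class_add_def ae_class_lsection_of image_UN)
qed

lemma class_scale_lsection_of:
  "class_scale \<mu> (lsection_of ` V) (\<lambda>c. lscale (\<lambda>x. c)) c (lsection_of ` a) =
   lsection_of ` class_scale \<mu> V (\<lambda>c f x. c * f x) c a"
proof -
  have "lscale (\<lambda>x. c) (lsection_of f) = lsection_of (\<lambda>x. c * f x)" for f :: "'a \<Rightarrow> complex"
    by (simp add: lscale_def lsection_of_def)
  then show ?thesis by (simp add: class_scale_def ae_class_lsection_of image_UN)
qed

text \<open>The representatives chosen in a class of sections and in the corresponding class of functions need not correspond
  to each other, but inner products do not depend on the choice.\<close>

lemma class_inner_lsection_of:
  assumes "f \<in> L2_functions \<mu>" "g \<in> L2_functions \<mu>"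
  shows "class_inner (section_inner \<mu> triv_h)
    (lsection_of ` ae_class \<mu> (L2_functions \<mu>) f) (lsection_of ` ae_class \<mu> (L2_functions \<mu>) g) =
    function_inner \<mu> f g"
proof -
  let ?F = "lsection_of ` ae_class \<mu> (L2_functions \<mu>) f" and ?G = "lsection_of ` ae_class \<mu> (L2_functions \<mu>) g"
  have "?F \<noteq> {}" "?G \<noteq> {}" using ae_class_self[OF assms(1)] ae_class_self[OF assms(2)] by blast+
  then have "(SOME s. s \<in> ?F) \<in> ?F" "(SOME s. s \<in> ?G) \<in> ?G" by (simp_all add: some_in_eq del: image_is_empty)
  then obtain f' g' where "f' \<in> ae_class \<mu> (L2_functions \<mu>) f" "g' \<in> ae_class \<mu> (L2_functions \<mu>) g"
    and eq: "(SOME s. s \<in> ?F) = lsection_of f'" "(SOME s. s \<in> ?G) = lsection_of g'"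
    by blast
  then have "function_inner \<mu> f' g' = function_inner \<mu> f g"
    using assms by (intro function_inner_cong_AE) (auto simp: ae_class_def)
  then show ?thesis unfolding class_inner_def eq by (simp add: section_inner_lsection_of)
qed

text \<open>Continuous functions on a compact space are bounded, and bounded functions are square integrable for a finite measure.
  This makes the pairings with test functions absolutely convergent.\<close>

lemma smooth_fun_L2:
  fixes A :: "('m::t2_space, 'k::finite) chart set"
  assumes "smooth_atlas A" "compact (UNIV :: 'm set)" "finite_measure \<mu>" "sets \<mu> = sets borel" "smooth_fun A f"
  shows "f \<in> L2_functions \<mu>"
proof -
  interpret finite_measure \<mu> by (rule assms(3))
  have c: "continuous_on UNIV f" by (rule smooth_fun_on_continuous[OF assms(1) open_UNIV assms(5)])
  then have meas: "f \<in> borel_measurable \<mu>"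
    using borel_measurable_continuous_onI measurable_cong_sets[OF assms(4) refl] by blast
  have "bounded (range f)" using compact_imp_bounded compact_continuous_image[OF c assms(2)] by blast
  then obtain b where b: "\<And>x. cmod (f x) \<le> b" unfolding bounded_iff by blast
  have "integrable \<mu> (\<lambda>x. (cmod (f x))\<^sup>2)"
    using meas b by (intro integrable_const_bound[where B = "b\<^sup>2"]) (auto intro!: power_mono)
  with meas show ?thesis by (simp add: L2_functions_def)
qed

text \<open>Closure under addition is the point where finiteness of the measure enters: the weak equation for \<open>f + g\<close> splits
  once the products of \<open>f\<close> and \<open>g\<close> with test functions are known to be integrable.\<close>

lemma L2_CR_functions_closed:
  fixes A :: "('m::t2_space, 'k::finite) chart set"
  assumes "smooth_atlas A" "compact (UNIV :: 'm set)" "finite_measure \<mu>" "sets \<mu> = sets borel"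
  shows "(\<lambda>x. 0) \<in> L2_CR_functions A \<mu> E10"
    and "f \<in> L2_CR_functions A \<mu> E10 \<Longrightarrow> g \<in> L2_CR_functions A \<mu> E10 \<Longrightarrow> (\<lambda>x. f x + g x) \<in> L2_CR_functions A \<mu> E10"
    and "f \<in> L2_CR_functions A \<mu> E10 \<Longrightarrow> (\<lambda>x. c * f x) \<in> L2_CR_functions A \<mu> E10"
proof -
  show "(\<lambda>x. 0) \<in> L2_CR_functions A \<mu> E10"
    by (simp add: L2_CR_functions_def L2_functions_def distributional_zero_def function_inner_def)
  show "(\<lambda>x. c * f x) \<in> L2_CR_functions A \<mu> E10" if "f \<in> L2_CR_functions A \<mu> E10"
    using that by (simp add: L2_CR_functions_def L2_functions_scale distributional_zero_def function_inner_scale)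
  show "(\<lambda>x. f x + g x) \<in> L2_CR_functions A \<mu> E10"
    if f: "f \<in> L2_CR_functions A \<mu> E10" and g: "g \<in> L2_CR_functions A \<mu> E10"
  proof -
    have fg: "f \<in> L2_functions \<mu>" "g \<in> L2_functions \<mu>" using f g by (simp_all add: L2_CR_functions_def)
    have "function_inner \<mu> (\<lambda>x. f x + g x) t = function_inner \<mu> f t + function_inner \<mu> g t"
      if "smooth_fun A t" for t
      using function_inner_add[OF fg smooth_fun_L2[OF assms that]] .
    with f g L2_functions_add[OF fg] show ?thesis
      by (simp add: L2_CR_functions_def distributional_zero_def)
  qed
qed

lemma CR_spaces_unitary_iso:
  fixes A :: "('m::t2_space, 'k::finite) chart set"
  assumes "smooth_atlas A" "compact (UNIV :: 'm set)" "finite_measure \<mu>" "sets \<mu> = sets borel"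
  shows "unitary_iso
      (ae_class \<mu> (L2_sections \<mu> triv_h) ` L2_CR_sections A \<mu> E10 triv_h)
      (class_add \<mu> (L2_sections \<mu> triv_h) ladd)
      (class_scale \<mu> (L2_sections \<mu> triv_h) (\<lambda>c. lscale (\<lambda>x. c)))
      (class_inner (section_inner \<mu> triv_h))
      (CR_function_space A \<mu> E10)
      (class_add \<mu> (L2_functions \<mu>) (\<lambda>f g x. f x + g x))
      (class_scale \<mu> (L2_functions \<mu>) (\<lambda>c f x. c * f x))
      (class_inner (function_inner \<mu>))
      (\<lambda>S. (\<lambda>s x. snd (s x)) ` S)"
proof -
  let ?L = "L2_functions \<mu>" and ?W = "CR_function_space A \<mu> E10"
  have W: "?W = ae_class \<mu> ?L ` L2_CR_functions A \<mu> E10" by (simp add: CR_function_space_def)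
  have V: "ae_class \<mu> (L2_sections \<mu> triv_h) ` L2_CR_sections A \<mu> E10 triv_h = (`) lsection_of ` ?W"
    by (simp add: W L2_sections_eq L2_CR_sections_eq image_image ae_class_lsection_of)
  have F: "(\<lambda>s x. snd (s x)) ` lsection_of ` C = C" for C :: "('m \<Rightarrow> complex) set"
    by (simp add: image_image)
  have L: "f \<in> ?L" if "f \<in> L2_CR_functions A \<mu> E10" for f using that by (simp add: L2_CR_functions_def)
  note closed = L2_CR_functions_closed[OF assms, where ?E10.0 = E10]
  have ne: "?W \<noteq> {}" using closed(1) by (auto simp: W)
  have add: "class_add \<mu> ?L (\<lambda>f g x. f x + g x) a b \<in> ?W" if "a \<in> ?W" "b \<in> ?W" for a b
    using that by (auto simp: W class_add_ae_class L intro!: imageI closed(2))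
  have scale: "class_scale \<mu> ?L (\<lambda>c f x. c * f x) c a \<in> ?W" if "a \<in> ?W" for a c
    using that by (auto simp: W class_scale_ae_class L intro!: imageI closed(3))
  have inner: "class_inner (section_inner \<mu> triv_h) (lsection_of ` a) (lsection_of ` b) =
      class_inner (function_inner \<mu>) a b" if "a \<in> ?W" "b \<in> ?W" for a b
    using that by (auto simp: W class_inner_lsection_of class_inner_ae_class L)
  have bij: "bij_betw (\<lambda>S. (\<lambda>s x. snd (s x)) ` S) ((`) lsection_of ` ?W) ?W"
    by (rule bij_betw_byWitness[where f' = "(`) lsection_of"]) (auto simp: F)
  show ?thesis
    unfolding unitary_iso_def V
    by (intro conjI bij ne)
      (auto simp: L2_sections_eq class_add_lsection_of class_scale_lsection_of F inner ne
        intro!: imageI add scale)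
qed

context pseudoconvex_CR_manifold
begin

section \<open>Finiteness of the contact measure\<close>

lemma contact_volume_form_vscale:
  assumes "\<And>j. X j \<in> fields A"
  shows "contact_volume_form A n \<theta> p (\<lambda>j. vscale c (X j p)) = c ^ (2*n+1) * contact_volume_form A n \<theta> p (\<lambda>j. X j p)"
proof -
  have "\<theta> p (vscale c (X i p)) = c * \<theta> p (X i p)" for i
    by (rule theta_vscale[OF fieldsD(1)[OF assms]])
  moreover have "ext_d A \<theta> p (vscale c (X i p)) (vscale c (X j p)) = c\<^sup>2 * ext_d A \<theta> p (X i p) (X j p)" for i j
    using ext_d_vscale[OF assms assms] by (simp add: power2_eq_square)
  ultimately have *: "of_int (sign \<sigma>) * \<theta> p (vscale c (X (\<sigma> 0) p)) *
      (\<Prod>j<n. ext_d A \<theta> p (vscale c (X (\<sigma> (2*j+1)) p)) (vscale c (X (\<sigma> (2*j+2)) p))) =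
    c ^ (2*n+1) * (of_int (sign \<sigma>) * \<theta> p (X (\<sigma> 0) p) *
      (\<Prod>j<n. ext_d A \<theta> p (X (\<sigma> (2*j+1)) p) (X (\<sigma> (2*j+2)) p)))" for \<sigma>
    by (simp add: prod.distrib power_mult[symmetric])
  then show ?thesis
    unfolding contact_volume_form_def by (simp only: * sum_distrib_left times_divide_eq_right)
qed

lemma contact_volume_form_continuous:
  assumes "\<And>j. X j \<in> fields A"
  shows "continuous_on UNIV (\<lambda>p. contact_volume_form A n \<theta> p (\<lambda>j. X j p))"
proof -
  have "continuous_on UNIV (\<lambda>p. \<theta> p (X i p))" for i
    by (rule smooth_fun_on_continuous[OF atlas open_UNIV theta_smooth[OF assms]])
  moreover have "continuous_on UNIV (\<lambda>p. ext_d A \<theta> p (X i p) (X j p))" for i j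
    by (rule smooth_fun_on_continuous[OF atlas open_UNIV ext_d_smooth[OF assms assms]])
  ultimately show ?thesis
    unfolding contact_volume_form_def
    by (intro continuous_on_divide continuous_on_sum continuous_on_mult continuous_on_prod continuous_on_const) auto
qed

text \<open>The coordinate vectors are fields on \<open>U\<close> only. Near \<open>p\<close> they are \<open>1 / \<eta>\<close> times global fields, for which continuity is
  known, and the volume form is homogeneous of degree \<open>2 * n + 1\<close>.\<close>

lemma chart_density_continuous:
  assumes c: "(U, \<phi>) \<in> A"
  shows "continuous_on U (\<lambda>p. contact_volume_form A n \<theta> p (\<lambda>j. coord_vec A (U, \<phi>) p (e j)))"
    (is "continuous_on U ?g")
proof -
  note ch = smooth_atlas_chart[OF atlas c]
  have "continuous (at p) ?g" if p: "p \<in> U" for p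
  proof -
    obtain \<eta> :: "'m \<Rightarrow> complex" and K
      where \<eta>: "smooth_fun A \<eta>" "\<eta> p = 1" and K: "closed K" "K \<subseteq> U" "\<And>q. q \<notin> K \<Longrightarrow> \<eta> q = 0"
      using manifold_bump[OF atlas ch(1) p] by metis
    have \<eta>c: "continuous_on UNIV \<eta>" by (rule smooth_fun_on_continuous[OF atlas open_UNIV \<eta>(1)])
    define X where "X j q = vscale (\<eta> q) (coord_vec A (U, \<phi>) q (e j))" for j q
    have X: "X j \<in> fields A" for j
      unfolding X_def
      by (rule smooth_field_on_cutoff[OF atlas ch(1) K(1,2) \<eta>(1) K(3) coord_vec_smooth_field[OF atlas c]])
    define V where "V = {q. \<eta> q \<noteq> 0}"
    have V: "open V" "p \<in> V"
      using open_Collect_neq[OF \<eta>c continuous_on_const] \<eta>(2) by (auto simp: V_def)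
    have "(1 / \<eta> q) ^ (2*n+1) * contact_volume_form A n \<theta> q (\<lambda>j. X j q) = ?g q" if "q \<in> V" for q
    proof -
      have "coord_vec A (U, \<phi>) q (e j) = vscale (1 / \<eta> q) (X j q)" for j
        using that by (simp add: X_def V_def vscale_def)
      then show ?thesis using contact_volume_form_vscale[OF X, of q "1 / \<eta> q"] by simp
    qed
    moreover have "continuous_on V (\<lambda>q. (1 / \<eta> q) ^ (2*n+1) * contact_volume_form A n \<theta> q (\<lambda>j. X j q))"
      by (intro continuous_on_mult continuous_on_power continuous_on_divide continuous_on_const
          continuous_on_subset[OF \<eta>c] continuous_on_subset[OF contact_volume_form_continuous[OF X]])
        (auto simp: V_def)
    ultimately have "continuous_on V ?g" by (rule continuous_on_eq[rotated])
    then show ?thesis using V by (simp add: continuous_on_eq_continuous_at)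
  qed
  then show ?thesis by (simp add: continuous_at_imp_continuous_on)
qed

text \<open>The density is continuous, hence bounded on the compact image of \<open>K\<close>, which has finite Lebesgue measure.\<close>

lemma chart_volume_compact_finite:
  assumes c: "(U, \<phi>) \<in> A" and K: "compact K" "K \<subseteq> U"
  shows "emeasure (chart_volume A n \<theta> (U, \<phi>)) K < \<infinity>"
proof -
  note ch = smooth_atlas_chart[OF atlas c]
  define \<rho> where "\<rho> p = cmod (contact_volume_form A n \<theta> p (\<lambda>j. coord_vec A (U, \<phi>) p (from_nat_into UNIV j)))" for p
  let ?N = "restrict_space lborel (\<phi> ` U)" and ?i = "inv_into U \<phi>"
  have \<rho>c: "continuous_on U \<rho>"
    unfolding \<rho>_def by (intro continuous_on_norm chart_density_continuous c)
  have ic: "continuous_on (\<phi> ` U) ?i" and \<phi>c: "continuous_on U \<phi>" using ch(4) by (auto simp: homeomorphism_def)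
  have im: "?i \<in> measurable ?N borel"
    using borel_measurable_continuous_on_restrict[OF ic]
    by (simp cong: measurable_cong_sets sets_restrict_space_cong)
  have "continuous_on (\<phi> ` U) (\<lambda>y. \<rho> (?i y))"
    by (rule continuous_on_compose2[OF \<rho>c ic]) (auto simp: inv_into_into)
  then have gm: "(\<lambda>y. ennreal (\<rho> (?i y))) \<in> borel_measurable ?N"
    using borel_measurable_continuous_on_restrict
    by (intro measurable_compose[OF _ measurable_ennreal])
      (simp cong: measurable_cong_sets sets_restrict_space_cong)
  obtain b where b: "\<And>p. p \<in> K \<Longrightarrow> \<rho> p \<le> b"
    using compact_imp_bounded[OF compact_continuous_image[OF continuous_on_subset[OF \<rho>c K(2)] K(1)]]
    unfolding bounded_iff by (auto simp: \<rho>_def)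
  have S: "?i -` K \<inter> \<phi> ` U = \<phi> ` K"
    using K(2) ch(3) by (auto simp: inv_into_f_f image_iff)
  have Kc: "compact (\<phi> ` K)" by (rule compact_continuous_image[OF continuous_on_subset[OF \<phi>c K(2)] K(1)])
  have Sm: "\<phi> ` K \<in> sets ?N"
    using compact_imp_closed[OF Kc] K(2) ch(2) by (subst sets_restrict_space_iff) auto
  have Km: "K \<in> sets borel" using compact_imp_closed[OF K(1)] by simp
  have "chart_volume A n \<theta> (U, \<phi>) = distr (density ?N (\<lambda>y. ennreal (\<rho> (?i y)))) borel ?i"
    by (simp add: chart_volume_def \<rho>_def Let_def)
  then have "emeasure (chart_volume A n \<theta> (U, \<phi>)) K =
      emeasure (density ?N (\<lambda>y. ennreal (\<rho> (?i y)))) (?i -` K \<inter> space ?N)"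
    using im Km by (simp add: emeasure_distr)
  also have "?i -` K \<inter> space ?N = \<phi> ` K" using S by (simp add: space_restrict_space)
  also have "emeasure (density ?N (\<lambda>y. ennreal (\<rho> (?i y)))) (\<phi> ` K) =
      (\<integral>\<^sup>+ y. ennreal (\<rho> (?i y)) * indicator (\<phi> ` K) y \<partial>?N)"
    by (rule emeasure_density[OF gm Sm])
  also have "\<dots> \<le> (\<integral>\<^sup>+ y. ennreal b * indicator (\<phi> ` K) y \<partial>?N)"
  proof (rule nn_integral_mono)
    fix y
    have "\<rho> (?i y) \<le> b" if "y \<in> \<phi> ` K" using that b K(2) ch(3) by auto
    then show "ennreal (\<rho> (?i y)) * indicator (\<phi> ` K) y \<le> ennreal b * indicator (\<phi> ` K) y"
      by (auto simp: indicator_def intro: ennreal_leI)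
  qed
  also have "\<dots> = ennreal b * emeasure ?N (\<phi> ` K)" by (rule nn_integral_cmult_indicator[OF Sm])
  also have "emeasure ?N (\<phi> ` K) = emeasure lborel (\<phi> ` K)"
    using K(2) ch(2) by (intro emeasure_restrict_space) auto
  also have "ennreal b * emeasure lborel (\<phi> ` K) < \<infinity>"
    using emeasure_bounded_finite[OF compact_imp_bounded[OF Kc]] by (simp add: ennreal_mult_less_top)
  finally show ?thesis .
qed

end

text \<open>Each point has a bump supported in a chart domain; finitely many of the sets where the bumps are
  nonzero cover \<open>M\<close>, and the supports are compact.\<close>

lemma compact_chart_cover_exists:
  fixes A :: "('m::t2_space, 'k::finite) chart set"
  assumes "smooth_atlas A" "compact (UNIV :: 'm set)"
  obtains cs where "compact_chart_cover A cs"
proof -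
  have "\<exists>x. fst x \<in> A \<and> compact (fst (snd x)) \<and> fst (snd x) \<subseteq> fst (fst x) \<and>
      open (snd (snd x)) \<and> p \<in> snd (snd x) \<and> snd (snd x) \<subseteq> fst (snd x)" for p :: 'm
  proof -
    obtain U \<phi> where c: "(U, \<phi>) \<in> A" "p \<in> U" by (rule smooth_atlas_covers[OF assms(1)])
    obtain \<eta> :: "'m \<Rightarrow> complex" and K
      where \<eta>: "smooth_fun A \<eta>" "\<eta> p = 1" and K: "closed K" "K \<subseteq> U" "\<And>q. q \<notin> K \<Longrightarrow> \<eta> q = 0"
      using manifold_bump[OF assms(1) smooth_atlas_chart(1)[OF assms(1) c(1)] c(2)] by metis
    have "open {q. \<eta> q \<noteq> 0}"
      using open_Collect_neq[OF smooth_fun_on_continuous[OF assms(1) open_UNIV \<eta>(1)] continuous_on_const] .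
    moreover have "compact K" using compact_Int_closed[OF assms(2) K(1)] by simp
    moreover have "{q. \<eta> q \<noteq> 0} \<subseteq> K" using K(3) by blast
    ultimately show ?thesis
      using c(1) K(2) \<eta>(2)
      by (intro exI[of _ "((U, \<phi>), K, {q. \<eta> q \<noteq> 0})"]) simp
  qed
  then obtain x where x: "\<And>p::'m. fst (x p) \<in> A \<and> compact (fst (snd (x p))) \<and> fst (snd (x p)) \<subseteq> fst (fst (x p)) \<and>
      open (snd (snd (x p))) \<and> p \<in> snd (snd (x p)) \<and> snd (snd (x p)) \<subseteq> fst (snd (x p))"
    by metis
  define c K W where "c p = fst (x p)" and "K p = fst (snd (x p))" and "W p = snd (snd (x p))" for p
  have ckw: "c p \<in> A" "compact (K p)" "K p \<subseteq> fst (c p)" "open (W p)" "p \<in> W p" "W p \<subseteq> K p" for p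
    using x[of p] by (auto simp: c_def K_def W_def)
  have cover: "UNIV \<subseteq> (\<Union>p\<in>UNIV. W p)"
  proof
    fix p show "p \<in> (\<Union>p\<in>UNIV. W p)" using ckw(5)[of p] by (rule UN_I[OF UNIV_I])
  qed
  obtain F where F: "finite F" "UNIV \<subseteq> (\<Union>p\<in>F. W p)"
    by (rule compactE_image[OF assms(2) _ cover]) (auto simp: ckw(4))
  obtain xs where xs: "set xs = F" using finite_list[OF F(1)] by blast
  have "(\<Union>p\<in>F. W p) \<subseteq> (\<Union>p\<in>F. K p)" by (rule UN_mono[OF subset_refl ckw(6)])
  with F(2) have "(\<Union>p\<in>F. K p) = UNIV" by auto
  then have "compact_chart_cover A (map (\<lambda>p. (c p, K p)) xs)"
    using ckw(1-3) by (auto simp: compact_chart_cover_def xs)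
  then show thesis by (rule that)
qed

context pseudoconvex_CR_manifold
begin

lemma sets_contact_measure: "sets (contact_measure A n \<theta>) = sets borel"
  using sets.sigma_sets_eq[of borel] by (simp add: contact_measure_def Let_def)

text \<open>If the set function assembled from the charts is not countably additive, \<open>measure_of\<close> yields the null
  measure; otherwise the total mass is a finite sum of masses of subsets of compact sets in chart domains.\<close>

lemma contact_measure_finite:
  assumes "compact (UNIV :: 'm set)"
  shows "finite_measure (contact_measure A n \<theta>)"
proof (rule finite_measureI)
  define cs where "cs = (SOME cs. compact_chart_cover A cs)"
  have "\<exists>cs. compact_chart_cover A cs" using compact_chart_cover_exists[OF atlas assms] by blast
  then have cs: "compact_chart_cover A cs" unfolding cs_def by (rule someI_ex)
  define m where "m = (\<lambda>B. \<Sum>i<length cs. emeasure (chart_volume A n \<theta> (fst (cs ! i)))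
    (B \<inter> (snd (cs ! i) - (\<Union>j<i. snd (cs ! j)))))" for B
  have \<mu>: "contact_measure A n \<theta> = measure_of UNIV (sets borel) m"
    by (simp add: contact_measure_def cs_def m_def Let_def)
  have "emeasure (chart_volume A n \<theta> (fst (cs ! i))) (UNIV \<inter> (snd (cs ! i) - (\<Union>j<i. snd (cs ! j)))) < \<infinity>"
    if i: "i < length cs" for i
  proof -
    obtain U \<phi> K where csi: "cs ! i = ((U, \<phi>), K)" by (metis prod.exhaust)
    have "((U, \<phi>), K) \<in> set cs" using nth_mem[OF i] csi by simp
    then have c: "(U, \<phi>) \<in> A" "compact K" "K \<subseteq> U"
      using cs unfolding compact_chart_cover_def by fastforce+
    have "K \<in> sets (chart_volume A n \<theta> (U, \<phi>))"
      using compact_imp_closed[OF c(2)] by (simp add: chart_volume_def)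
    then have "emeasure (chart_volume A n \<theta> (U, \<phi>)) (UNIV \<inter> (K - (\<Union>j<i. snd (cs ! j)))) \<le>
        emeasure (chart_volume A n \<theta> (U, \<phi>)) K"
      by (intro emeasure_mono) auto
    also have "\<dots> < \<infinity>" by (rule chart_volume_compact_finite[OF c])
    finally show ?thesis by (simp add: csi)
  qed
  then have "m UNIV < \<infinity>" unfolding m_def by simp
  then show "emeasure (contact_measure A n \<theta>) (space (contact_measure A n \<theta>)) \<noteq> \<infinity>"
    unfolding \<mu> by (simp add: emeasure_measure_of_conv less_top)
qed

end

section \<open>Polarized sections and CR-holomorphic functions\<close>

theorem proposition3p22:
  fixes A :: "('m::{t2_space, second_countable_topology} set \<times> ('m \<Rightarrow> real ^ 'k::finite)) set"
    and n :: nat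
    and E10 :: "'m \<Rightarrow> (('m \<Rightarrow> complex) \<Rightarrow> complex) set"
    and \<theta> :: "'m \<Rightarrow> (('m \<Rightarrow> complex) \<Rightarrow> complex) \<Rightarrow> complex"
  defines "E \<equiv> levi_distribution E10"
    and "P \<equiv> E10"
    and "\<Omega> \<equiv> (\<lambda>p v w. - ext_d A \<theta> p v w)"
    and "nabla \<equiv> triv_conn \<theta>"
    and "\<mu> \<equiv> contact_measure A n \<theta>"
  assumes "compact (UNIV :: 'm set)"
    and "strongly_pseudoconvex_CR A n E10 \<theta>"
  shows "cr_polarization A E \<Omega> P \<and>
    quantum_bundle A E \<Omega> triv_h nabla \<and>
    (\<forall>s\<in>smooth_lsections A. polarized A P nabla s \<longleftrightarrow> dbar_L E10 s = dual_zero) \<and>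
    L2_polarized A \<mu> P triv_h nabla = L2_CR_sections A \<mu> E10 triv_h \<and>
    unitary_iso
      (quantum_space A \<mu> P triv_h nabla)
      (class_add \<mu> (L2_sections \<mu> triv_h) ladd)
      (class_scale \<mu> (L2_sections \<mu> triv_h) (\<lambda>c. lscale (\<lambda>x. c)))
      (class_inner (section_inner \<mu> triv_h))
      (CR_function_space A \<mu> E10)
      (class_add \<mu> (L2_functions \<mu>) (\<lambda>f g x. f x + g x))
      (class_scale \<mu> (L2_functions \<mu>) (\<lambda>c f x. c * f x))
      (class_inner (function_inner \<mu>))
      (\<lambda>S. (\<lambda>s x. snd (s x)) ` S)"
proof -
  interpret pseudoconvex_CR_manifold A n E10 \<theta> by unfold_locales (rule assms)
  have Q: "quantum_space A \<mu> P triv_h nabla =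
      ae_class \<mu> (L2_sections \<mu> triv_h) ` L2_CR_sections A \<mu> E10 triv_h"
    by (simp add: quantum_space_def P_def nabla_def L2_polarized_eq_L2_CR_sections)
  have "finite_measure \<mu>" "sets \<mu> = sets borel"
    unfolding \<mu>_def by (rule contact_measure_finite[OF assms(6)] sets_contact_measure)+
  from CR_spaces_unitary_iso[OF atlas assms(6) this, of E10] Q
  show ?thesis
    using E10_cr_polarization triv_quantum_bundle polarized_iff_dbar_L L2_polarized_eq_L2_CR_sections
    by (simp add: E_def P_def \<Omega>_def nabla_def)
qed

end
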